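(* Let $n\ge1$, let the couplings be independent and identically distributed, let $k\ge0$, $r\ge0$ and $0\le w<1$, and assume $\mathrm H_k(r,w)$. For $L,R>0$ put $$\rho:=\frac r{1-w},\quad\varpi:=2w+(2\rho R)^2+4\rho L,\quad\vartheta:=\frac{1+e^{-2L}}{\tanh R},\quad\Gamma:=\vartheta\sum_{g=1}^n\binom ng\kappa_g\,\varpi^{\,n-g}.$$ Then $\mathrm H_{k+1}(r\Gamma,\varpi^n)$ holds.
   Context: Lattice and effective couplings. $\mathbb D_0$ is a single edge between two poles. For $N\ge1$, $\mathbb D_N$ consists of $n$ branches in parallel between its two poles, each branch being two copies of $\mathbb D_{N-1}$ (its halves) in series. A scale-$k$ sub-diamond is a copy of $\mathbb D_k$. Edges carry i.i.d. real couplings $J_e$; $\beta\ge0$ is the inverse temperature. For pole spins $s,s'\in\{-1,1\}$ let $Z_D(s,s')$ be the sum of $\exp(\beta\sum_{e=xy\in E(D)}J_e\sigma_x\sigma_y)$ over the interior (non-pole) spins of $D$, and $\xi_D:=\frac12\log(Z_D(+,+)/Z_D(+,-))$; $\xi_k$ is the effective coupling of a scale-$k$ sub-diamond. Equivalently, $\xi_0=\beta J_e$ and the effective coupling of a scale-$(k+1)$ sub-diamond is $\sum_{i=1}^n\xi^{(i,1)}\star\xi^{(i,2)}$, where $\xi^{(i,1)},\xi^{(i,2)}$ are the effective couplings of the two halves of branch $i$ ($2n$ independent copies of $\xi_k$) and $a\star b=\operatorname{artanh}(\tanh a\tanh b)$. Definition of $\mathrm H_k(r,w)$, for $r,w\ge0$: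 there is an event $E_k$, measurable with respect to the couplings of a scale-$k$ sub-diamond and given by a fixed measurable function of its coupling vector (so that it is defined on every copy), with $\mathbb P(E_k^c)\le w$ and $\mathbb P(\xi_k\in dx,\,E_k)\le r\,dx$, i.e. $\mathbb P(\{\xi_k\in S\}\cap E_k)\le r|S|$ for every Borel $S\subset\mathbb R$. Constants: $p_2(x)=2(1-2|x|)_+$ on $\mathbb R$ and $\kappa_g:=p_2^{*g}(0)$ ($g$-fold convolution evaluated at $0$). *)

theory Defs
  imports "HOL-Probability.Probability"
begin

section \<open>The diamond lattice\<close>

text \<open>
  A \<^emph>\<open>half\<close> \<open>(i, h)\<close> of a diamond is the first (\<open>h = False\<close>) or second (\<open>h = True\<close>) copy of the
  next smaller diamond in branch \<open>i < n\<close>. A list of halves addresses a sub-diamond, outermost half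
  first; an edge of the diamond of scale \<open>N\<close> is an address of length \<open>N\<close>. The interior vertex
  \<open>Mid xs i\<close> is the midpoint of branch \<open>i\<close> of the sub-diamond with address \<open>xs\<close>.
\<close>

type_synonym half = "nat \<times> bool"

type_synonym edge = "half list"

datatype vertex = Pole1 | Pole2 | Mid "half list" nat

definition edges :: "nat \<Rightarrow> nat \<Rightarrow> edge set" where
  "edges n N = {xs. set xs \<subseteq> {..<n} \<times> UNIV \<and> length xs = N}"

definition verts :: "nat \<Rightarrow> nat \<Rightarrow> vertex set" where
  "verts n N = {Pole1, Pole2} \<union>
     {Mid xs i | xs i. set xs \<subseteq> {..<n} \<times> UNIV \<and> length xs < N \<and> i < n}"

text \<open>The embedding of the vertices of the half \<open>c\<close> into the surrounding diamond.\<close>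

fun embed :: "half \<Rightarrow> vertex \<Rightarrow> vertex" where
  "embed c (Mid xs j) = Mid (c # xs) j"
| "embed (i, False) Pole1 = Pole1"
| "embed (i, False) Pole2 = Mid [] i"
| "embed (i, True) Pole1 = Mid [] i"
| "embed (i, True) Pole2 = Pole2"

text \<open>The orientation of edges that this choice of endpoints induces is immaterial.\<close>

fun endpoints :: "edge \<Rightarrow> vertex \<times> vertex" where
  "endpoints [] = (Pole1, Pole2)"
| "endpoints (c # xs) = map_prod (embed c) (embed c) (endpoints xs)"

section \<open>Partition function and effective coupling\<close>

definition configs :: "nat \<Rightarrow> nat \<Rightarrow> real \<Rightarrow> real \<Rightarrow> (vertex \<Rightarrow> real) set" where
  "configs n N s s' = {\<sigma> \<in> verts n N \<rightarrow>\<^sub>E {-1, 1}. \<sigma> Pole1 = s \<and> \<sigma> Pole2 = s'}"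

definition partition_function ::
  "nat \<Rightarrow> real \<Rightarrow> nat \<Rightarrow> (edge \<Rightarrow> real) \<Rightarrow> real \<Rightarrow> real \<Rightarrow> real" where
  "partition_function n \<beta> N J s s' =
     (\<Sum>\<sigma>\<in>configs n N s s'.
        exp (\<beta> * (\<Sum>e\<in>edges n N. J e * \<sigma> (fst (endpoints e)) * \<sigma> (snd (endpoints e)))))"

definition eff_coupling :: "nat \<Rightarrow> real \<Rightarrow> nat \<Rightarrow> (edge \<Rightarrow> real) \<Rightarrow> real" where
  "eff_coupling n \<beta> N J =
     ln (partition_function n \<beta> N J 1 1 / partition_function n \<beta> N J 1 (-1)) / 2"

section \<open>The hypothesis H\<close>

text \<open>\<open>\<mu>\<close> is the common law of the edge couplings.\<close>

definition coupling_law :: "nat \<Rightarrow> real measure \<Rightarrow> nat \<Rightarrow> (edge \<Rightarrow> real) measure" where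
  "coupling_law n \<mu> k = (\<Pi>\<^sub>M e\<in>edges n k. \<mu>)"

lemma eff_coupling_measurable:
  assumes "sets \<mu> = sets borel"
  shows "eff_coupling n \<beta> k \<in> borel_measurable (coupling_law n \<mu> k)"
proof -
  have [measurable]: "(\<lambda>J. J e) \<in> borel_measurable (coupling_law n \<mu> k)" if "e \<in> edges n k" for e
    using measurable_component_singleton[OF that, of "\<lambda>_. \<mu>"] measurable_cong_sets[OF refl assms]
    unfolding coupling_law_def by auto
  show ?thesis
    unfolding eff_coupling_def[abs_def] partition_function_def by measurable
qed

definition H :: "nat \<Rightarrow> real \<Rightarrow> real measure \<Rightarrow> nat \<Rightarrow> real \<Rightarrow> real \<Rightarrow> bool" where
  "H n \<beta> \<mu> k r w \<longleftrightarrow>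
     (\<exists>E \<in> sets (coupling_law n \<mu> k).
        measure (coupling_law n \<mu> k) (space (coupling_law n \<mu> k) - E) \<le> w \<and>
        (\<forall>S \<in> sets (borel :: real measure).
           emeasure (coupling_law n \<mu> k) (eff_coupling n \<beta> k -` S \<inter> E)
             \<le> ennreal r * emeasure lborel S))"

section \<open>The constants kappa\<close>

definition conv :: "(real \<Rightarrow> real) \<Rightarrow> (real \<Rightarrow> real) \<Rightarrow> real \<Rightarrow> real" where
  "conv f g x = (LINT y|lborel. f (x - y) * g y)"

definition p2 :: "real \<Rightarrow> real" where
  "p2 x = 2 * max 0 (1 - 2 * \<bar>x\<bar>)"

text \<open>Only meaningful for \<open>g \<ge> 1\<close>.\<close>

definition kappa :: "nat \<Rightarrow> real" where
  "kappa g = (conv p2 ^^ (g - 1)) p2 0"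

end

theory Submission
  imports Defs
begin

text \<open>
  The effective coupling of the larger diamond is the sum over its branches of
  \<open>star a b = artanh (tanh a * tanh b)\<close>, where \<open>a\<close> and \<open>b\<close> are the independent effective couplings of
  the two halves (\<open>eff_coupling_Suc\<close>, \<open>distr_branch_pairs\<close>). Call a branch good if both halves lie in
  the given event, the larger of \<open>\<bar>a\<bar>\<close>, \<open>\<bar>b\<bar>\<close> exceeds \<open>R\<close>, and these moduli differ by more than \<open>L\<close>.
  A branch is bad with probability at most \<open>\<omega>\<close> (\<open>bad_pairs_bound\<close>). The new event is that
  some branch is good; it fails with probability at most \<open>\<omega> ^ n\<close>.

  On a good branch, with the half of larger modulus held fixed, \<open>star a b\<close> as a function of the other
  half has slope at least \<open>1 / \<theta>\<close> (\<open>tanh_average_ge\<close>). This alone bounds the density of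
  a single branch by \<open>2 * r * \<theta>\<close>, but the constants for sums of branches need more: the mass
  available to the smaller half is limited by the position of the larger one, as for the law of the
  one of smaller modulus among two independent variables. After
  multiplication by \<open>r * \<theta>\<close> the law of a good branch is therefore less concentrated than the
  triangle \<open>p2\<close> (\<open>branch_majorized\<close>).

  Being less concentrated than a symmetric decreasing density is preserved by convolution
  (\<open>majorized_convolution\<close>), which is a form of Riesz's rearrangement inequality. It is reduced by
  layer cakes to overlaps of two sets (\<open>overlap_excess_le\<close>). Hence the sum of \<open>g\<close> scaled good branches
  has density at most the \<open>g\<close>-fold convolution power of \<open>p2\<close> at \<open>0\<close>, which is \<open>kappa g\<close>. The bad branches
  only translate this sum, and summation over the possible sets of good branches yields \<open>\<Gamma>\<close>
  (\<open>some_good_density_bound\<close>).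
\<close>

section \<open>Measures dominated by symmetric decreasing densities\<close>

text \<open>
  These are the symmetric decreasing functions of rearrangement theory.
\<close>

definition unimodal :: "(real \<Rightarrow> ennreal) \<Rightarrow> bool" where
  "unimodal h \<longleftrightarrow> h \<in> borel_measurable borel \<and> (\<forall>x y. \<bar>x\<bar> \<le> \<bar>y\<bar> \<longrightarrow> h y \<le> h x)"

text \<open>
  For a bounded unimodal \<open>h\<close> the infimum of the right-hand side over \<open>t\<close> is the integral of \<open>h\<close> over
  the centred interval whose length is that of \<open>S\<close>. The relation thus says that \<open>\<nu>\<close> is no more
  concentrated than the measure with density \<open>h\<close>. In this dual form neither rearranged functions
  nor densities of \<open>\<nu>\<close> have to be constructed.
\<close>

definition majorized :: "real measure \<Rightarrow> (real \<Rightarrow> ennreal) \<Rightarrow> bool" where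
  "majorized \<nu> h \<longleftrightarrow> (\<forall>S\<in>sets borel. \<forall>t\<ge>0.
     emeasure \<nu> S \<le> ennreal t * emeasure lborel S + (\<integral>\<^sup>+x. (h x - ennreal t) \<partial>lborel))"

definition super_level_length :: "(real \<Rightarrow> ennreal) \<Rightarrow> real \<Rightarrow> ennreal" where
  "super_level_length f s = emeasure lborel {x. ennreal s < f x}"

lemma unimodal_measurable [measurable_dest]: "unimodal h \<Longrightarrow> h \<in> borel_measurable borel"
  by (simp add: unimodal_def)

lemma unimodalD: "unimodal h \<Longrightarrow> \<bar>x\<bar> \<le> \<bar>y\<bar> \<Longrightarrow> h y \<le> h x"
  by (simp add: unimodal_def)

lemma unimodal_even: "unimodal h \<Longrightarrow> h (- x) = h x"
  by (intro antisym unimodalD[of h]) auto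

lemma super_level_measurable [measurable]:
  assumes [measurable]: "f \<in> borel_measurable borel"
  shows "super_level_length f \<in> borel_measurable borel"
proof -
  have "super_level_length f = (\<lambda>s. \<integral>\<^sup>+x. indicator {x. ennreal s < f x} x \<partial>lborel)"
    unfolding super_level_length_def by (intro ext) simp
  also have "\<dots> \<in> borel_measurable borel"
  proof -
    have *: "(\<lambda>s. \<integral>\<^sup>+x. (if ennreal s < f x then 1 else 0) \<partial>lborel) \<in> borel_measurable borel"
      by measurable
    show ?thesis using * by (simp add: indicator_def of_bool_def)
  qed
  finally show ?thesis .
qed

lemma super_level_antimono:
  assumes [measurable]: "f \<in> borel_measurable borel" and "s \<le> t"
  shows "super_level_length f t \<le> super_level_length f s"
  unfolding super_level_length_def
  by (rule emeasure_mono) (auto intro: le_less_trans ennreal_leI[OF \<open>s \<le> t\<close>])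

lemma ennreal_excess_eq_0: "x \<le> ennreal t \<Longrightarrow> x - ennreal t = 0"
  using diff_eq_0_iff_ennreal le_less_trans ennreal_less_top by blast

lemma excess_as_length:
  assumes "t \<ge> 0"
  shows "(a :: ennreal) - ennreal t = (\<integral>\<^sup>+s. indicator {t..} s * indicator {s. ennreal s < a} s \<partial>lborel)"
proof (cases a)
  case (real b)
  have *: "indicator {t..} s * indicator {s. ennreal s < a} s = (indicator {t..<b} s :: ennreal)" for s
    using real \<open>t \<ge> 0\<close> by (auto simp: indicator_def ennreal_less_iff)
  have "(\<integral>\<^sup>+s. indicator {t..} s * indicator {s. ennreal s < a} s \<partial>lborel) = (\<integral>\<^sup>+s. indicator {t..<b} s \<partial>lborel)"
    by (intro nn_integral_cong) (rule *)
  thus ?thesis using real \<open>t \<ge> 0\<close>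
    by (cases "t \<le> b"; simp add: ennreal_minus ennreal_neg)
next
  case top
  have *: "indicator {t..} s * indicator {s. ennreal s < a} s = (indicator {t..} s :: ennreal)" for s
    using top by (auto simp: indicator_def)
  have "emeasure lborel {t..} = (\<infinity>::ennreal)"
  proof (rule ccontr)
    assume fin: "emeasure lborel {t..} \<noteq> \<infinity>"
    then obtain c where c: "emeasure lborel {t..} = ennreal c" "c \<ge> 0" by (cases "emeasure lborel {t..}") auto
    have "emeasure lborel {t..t + (c + 1)} \<le> emeasure lborel {t..}" by (rule emeasure_mono) auto
    thus False using c by simp
  qed
  thus ?thesis using top by (simp add: *)
qed

lemma layer_cake:
  assumes "sigma_finite_measure M" and [measurable]: "f \<in> borel_measurable M" and "t \<ge> 0"
  shows "(\<integral>\<^sup>+x. (f x - ennreal t) \<partial>M)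
    = (\<integral>\<^sup>+s. indicator {t..} s * emeasure M {x\<in>space M. ennreal s < f x} \<partial>lborel)"
proof -
  interpret sigma_finite_measure M by fact
  interpret pair_sigma_finite M lborel ..
  have "(\<integral>\<^sup>+x. (f x - ennreal t) \<partial>M)
      = (\<integral>\<^sup>+x. (\<integral>\<^sup>+s. indicator {t..} s * indicator {s. ennreal s < f x} s \<partial>lborel) \<partial>M)"
    using excess_as_length[OF \<open>t \<ge> 0\<close>] by simp
  also have "\<dots> = (\<integral>\<^sup>+x. (\<integral>\<^sup>+s. (if t \<le> s \<and> ennreal s < f x then 1 else 0) \<partial>lborel) \<partial>M)"
    by (intro nn_integral_cong) (auto simp: indicator_def)
  also have "\<dots> = (\<integral>\<^sup>+s. (\<integral>\<^sup>+x. (if t \<le> s \<and> ennreal s < f x then 1 else 0) \<partial>M) \<partial>lborel)"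
    by (rule Fubini'[symmetric]) measurable
  also have "\<dots> = (\<integral>\<^sup>+s. indicator {t..} s * emeasure M {x\<in>space M. ennreal s < f x} \<partial>lborel)"
  proof (intro nn_integral_cong)
    fix s :: real
    have "(\<integral>\<^sup>+x. (if t \<le> s \<and> ennreal s < f x then 1 else 0) \<partial>M)
        = (\<integral>\<^sup>+x. indicator {t..} s * indicator {x\<in>space M. ennreal s < f x} x \<partial>M)"
      by (intro nn_integral_cong) (auto simp: indicator_def)
    also have "\<dots> = indicator {t..} s * emeasure M {x\<in>space M. ennreal s < f x}"
      by (subst nn_integral_cmult) auto
    finally show "(\<integral>\<^sup>+x. (if t \<le> s \<and> ennreal s < f x then 1 else 0) \<partial>M)
        = indicator {t..} s * emeasure M {x\<in>space M. ennreal s < f x}" .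
  qed
  finally show ?thesis .
qed

lemma layer_cake_lborel:
  assumes "f \<in> borel_measurable borel" "t \<ge> 0"
  shows "(\<integral>\<^sup>+x. (f x - ennreal t) \<partial>lborel) = (\<integral>\<^sup>+s. indicator {t..} s * super_level_length f s \<partial>lborel)"
  using layer_cake[of lborel f t] assms by (simp add: lborel.sigma_finite_measure_axioms super_level_length_def)

text \<open>
  A nonincreasing \<open>D\<close> exceeds \<open>l\<close> up to some level \<open>t\<close> and stays below \<open>l\<close> afterwards, so that the
  integral of \<open>min D l\<close> is \<open>t * l\<close> plus the integral of \<open>D\<close> beyond \<open>t\<close>. The level is finite because
  \<open>D\<close> vanishes eventually.
\<close>

lemma ex_optimal_level:
  fixes D :: "real \<Rightarrow> ennreal" and l :: ennreal
  assumes [measurable]: "D \<in> borel_measurable borel"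
    and mono: "\<And>s t. s \<le> t \<Longrightarrow> D t \<le> D s"
    and "\<And>s. s \<ge> b \<Longrightarrow> D s = 0"
  obtains t where "t \<ge> 0"
    "ennreal t * l + (\<integral>\<^sup>+s. indicator {t..} s * D s \<partial>lborel)
      \<le> (\<integral>\<^sup>+s. indicator {0..} s * min (D s) l \<partial>lborel)"
proof (cases "l = 0")
  case True
  have "(\<integral>\<^sup>+s. indicator {max 0 b..} s * D s \<partial>lborel) = (\<integral>\<^sup>+s. 0 \<partial>(lborel :: real measure))"
    by (intro nn_integral_cong) (auto simp: indicator_def assms(3))
  thus ?thesis using True by (intro that[of "max 0 b"]) auto
next
  case False
  define T where "T = insert 0 {s. 0 \<le> s \<and> l \<le> D s}"
  have T: "s \<le> max 0 b" if "s \<in> T" for s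
    using that assms(3)[of s] False by (cases "s \<ge> b") (auto simp: T_def)
  have bdd: "bdd_above T" by (rule bdd_aboveI[of _ "max 0 b"]) (rule T)
  define t where "t = Sup T"
  have t0: "t \<ge> 0" unfolding t_def using bdd by (intro cSup_upper) (auto simp: T_def)
  have below: "l \<le> D s" if s: "0 \<le> s" "s < t" for s
  proof -
    obtain u where "u \<in> T" "s < u"
      using s(2) bdd less_cSup_iff[of T s] unfolding t_def T_def by auto
    thus ?thesis using s(1) mono[of s u] by (auto simp: T_def)
  qed
  have above: "D s \<le> l" if "t < s" for s
  proof (rule ccontr)
    assume "\<not> D s \<le> l"
    hence "s \<in> T" using t0 that by (auto simp: T_def)
    hence "s \<le> t" unfolding t_def using bdd by (intro cSup_upper)
    thus False using that by simp
  qed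
  have "ennreal t * l + (\<integral>\<^sup>+s. indicator {t..} s * D s \<partial>lborel)
      = (\<integral>\<^sup>+s. l * indicator {0..<t} s \<partial>lborel) + (\<integral>\<^sup>+s. indicator {t..} s * D s \<partial>lborel)"
    using t0 by (subst nn_integral_cmult) (auto simp: mult.commute)
  also have "\<dots> = (\<integral>\<^sup>+s. l * indicator {0..<t} s + indicator {t..} s * D s \<partial>lborel)"
    by (rule nn_integral_add[symmetric]) auto
  also have "\<dots> \<le> (\<integral>\<^sup>+s. indicator {0..} s * min (D s) l \<partial>lborel)"
  proof (rule nn_integral_mono_AE)
    show "AE s in lborel. l * indicator {0..<t} s + indicator {t..} s * D s
        \<le> indicator {0..} s * min (D s) l"
      using AE_lborel_singleton[of t]
    proof eventually_elim
      case (elim s)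
      thus ?case using t0 below[of s] above[of s] by (auto simp: indicator_def min_def)
    qed
  qed
  finally show ?thesis using t0 by (intro that)
qed

text \<open>
  The left-hand side is at most \<open>t * l\<close> plus the tail of \<open>m\<close> beyond \<open>t\<close> for every \<open>t\<close>; comparing
  tails at the level that is optimal for \<open>D\<close> gives the right-hand side.
\<close>

lemma truncated_layers_mono:
  fixes m D :: "real \<Rightarrow> ennreal"
  assumes [measurable]: "m \<in> borel_measurable borel" "D \<in> borel_measurable borel"
    and "\<And>s t. s \<le> t \<Longrightarrow> D t \<le> D s" "\<And>s. s \<ge> b \<Longrightarrow> D s = 0"
    and le: "\<And>t. t \<ge> 0 \<Longrightarrow>
      (\<integral>\<^sup>+s. indicator {t..} s * m s \<partial>lborel) \<le> (\<integral>\<^sup>+s. indicator {t..} s * D s \<partial>lborel)"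
  shows "(\<integral>\<^sup>+s. indicator {0..} s * min (m s) l \<partial>lborel)
    \<le> (\<integral>\<^sup>+s. indicator {0..} s * min (D s) l \<partial>lborel)"
proof -
  obtain t where t: "t \<ge> 0"
    "ennreal t * l + (\<integral>\<^sup>+s. indicator {t..} s * D s \<partial>lborel)
      \<le> (\<integral>\<^sup>+s. indicator {0..} s * min (D s) l \<partial>lborel)"
    using ex_optimal_level[OF assms(2,3,4)] by blast
  have "(\<integral>\<^sup>+s. indicator {0..} s * min (m s) l \<partial>lborel)
      \<le> (\<integral>\<^sup>+s. l * indicator {0..<t} s + indicator {t..} s * m s \<partial>lborel)"
    using \<open>t \<ge> 0\<close> by (intro nn_integral_mono) (auto simp: indicator_def)
  also have "\<dots> = (\<integral>\<^sup>+s. l * indicator {0..<t} s \<partial>lborel) + (\<integral>\<^sup>+s. indicator {t..} s * m s \<partial>lborel)"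
    by (rule nn_integral_add) auto
  also have "\<dots> = ennreal t * l + (\<integral>\<^sup>+s. indicator {t..} s * m s \<partial>lborel)"
    using t(1) by (subst nn_integral_cmult) (auto simp: mult.commute)
  also have "\<dots> \<le> ennreal t * l + (\<integral>\<^sup>+s. indicator {t..} s * D s \<partial>lborel)"
    by (intro add_left_mono le t)
  finally show ?thesis using t(2) by simp
qed

lemma super_level_eq_0:
  assumes "\<And>x. h x \<le> ennreal b" "s \<ge> b" shows "super_level_length h s = 0"
proof -
  have "{x. ennreal s < h x} = {}"
    using assms(1) ennreal_leI[OF assms(2)] by (auto simp: not_less intro: order_trans)
  thus ?thesis by (simp add: super_level_length_def)
qed

text \<open>
  Superlevel sets of unimodal functions are centred intervals, hence nested.
\<close>

lemma unimodal_super_level_inter: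
  assumes "unimodal h" "unimodal k"
  shows "emeasure lborel ({x. ennreal s < k x} \<inter> {x. ennreal t < h x})
    = min (super_level_length k s) (super_level_length h t)"
proof -
  have [measurable]: "h \<in> borel_measurable borel" "k \<in> borel_measurable borel"
    using assms by auto
  have "{x. ennreal s < k x} \<subseteq> {x. ennreal t < h x} \<or> {x. ennreal t < h x} \<subseteq> {x. ennreal s < k x}"
  proof (rule ccontr)
    assume "\<not> ?thesis"
    then obtain x y where xy: "ennreal s < k x" "\<not> ennreal t < h x" "ennreal t < h y" "\<not> ennreal s < k y"
      by blast
    show False
      using unimodalD[OF assms(1), of x y] unimodalD[OF assms(2), of y x] xy
      by (cases "\<bar>x\<bar> \<le> \<bar>y\<bar>") auto
  qed
  thus ?thesis
  proof
    assume *: "{x. ennreal s < k x} \<subseteq> {x. ennreal t < h x}"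
    hence "super_level_length k s \<le> super_level_length h t" unfolding super_level_length_def by (intro emeasure_mono) auto
    thus ?thesis using * by (simp add: Int_absorb2 min_def super_level_length_def)
  next
    assume *: "{x. ennreal t < h x} \<subseteq> {x. ennreal s < k x}"
    hence "super_level_length h t \<le> super_level_length k s" unfolding super_level_length_def by (intro emeasure_mono) auto
    thus ?thesis using * by (simp add: Int_absorb1 min_absorb2 super_level_length_def)
  qed
qed

lemma majorized_le_truncated_layers:
  assumes "majorized \<nu> h" and h: "unimodal h" "\<And>x. h x \<le> ennreal b" and S: "S \<in> sets borel"
  shows "emeasure \<nu> S \<le> (\<integral>\<^sup>+t. indicator {0..} t * min (super_level_length h t) (emeasure lborel S) \<partial>lborel)"
proof -
  have [measurable]: "h \<in> borel_measurable borel" using h by auto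
  obtain t where t: "t \<ge> 0"
    "ennreal t * emeasure lborel S + (\<integral>\<^sup>+s. indicator {t..} s * super_level_length h s \<partial>lborel)
      \<le> (\<integral>\<^sup>+s. indicator {0..} s * min (super_level_length h s) (emeasure lborel S) \<partial>lborel)"
    using ex_optimal_level[of "super_level_length h" b "emeasure lborel S"]
      super_level_antimono super_level_eq_0[OF h(2)] by auto
  have "emeasure \<nu> S \<le> ennreal t * emeasure lborel S + (\<integral>\<^sup>+x. (h x - ennreal t) \<partial>lborel)"
    using assms(1) S t(1) by (auto simp: majorized_def)
  also have "(\<integral>\<^sup>+x. (h x - ennreal t) \<partial>lborel) = (\<integral>\<^sup>+s. indicator {t..} s * super_level_length h s \<partial>lborel)"
    using t(1) by (intro layer_cake_lborel) auto
  finally show ?thesis using t(2) by simp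
qed

lemma nn_integral_mult_unimodal:
  assumes h: "unimodal h" and k: "unimodal k"
  shows "(\<integral>\<^sup>+x. k x * h x \<partial>lborel) = (\<integral>\<^sup>+t. indicator {0..} t *
     (\<integral>\<^sup>+s. indicator {0..} s * min (super_level_length k s) (super_level_length h t) \<partial>lborel) \<partial>lborel)"
proof -
  have [measurable]: "h \<in> borel_measurable borel" "k \<in> borel_measurable borel"
    using assms by auto
  have cut: "(\<integral>\<^sup>+x. k x * indicator {x. ennreal t < h x} x \<partial>lborel)
      = (\<integral>\<^sup>+s. indicator {0..} s * min (super_level_length k s) (super_level_length h t) \<partial>lborel)" for t
  proof -
    let ?f = "\<lambda>x. k x * indicator {x. ennreal t < h x} x"
    have "(\<integral>\<^sup>+x. ?f x \<partial>lborel) = (\<integral>\<^sup>+s. indicator {0..} s * super_level_length ?f s \<partial>lborel)"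
      using layer_cake_lborel[of ?f 0] by simp
    also have "\<dots> = (\<integral>\<^sup>+s. indicator {0..} s * min (super_level_length k s) (super_level_length h t) \<partial>lborel)"
    proof (intro nn_integral_cong)
      fix s :: real
      have "{x. ennreal s < ?f x} = {x. ennreal s < k x} \<inter> {x. ennreal t < h x}" if "s \<ge> 0"
        by (auto simp: indicator_def split: if_splits)
      thus "indicator {0..} s * super_level_length ?f s
          = indicator {0..} s * min (super_level_length k s) (super_level_length h t)"
        using unimodal_super_level_inter[OF h k, of s t]
        by (cases "s \<ge> 0") (auto simp: super_level_length_def[of ?f])
    qed
    finally show ?thesis .
  qed
  have "(\<integral>\<^sup>+x. k x * h x \<partial>lborel)
      = (\<integral>\<^sup>+x. k x * (\<integral>\<^sup>+t. indicator {0..} t * indicator {t. ennreal t < h x} t \<partial>lborel) \<partial>lborel)"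
    using excess_as_length[of 0 "h _"] by simp
  also have "\<dots> = (\<integral>\<^sup>+x. (\<integral>\<^sup>+t. k x * (if 0 \<le> t \<and> ennreal t < h x then 1 else 0) \<partial>lborel) \<partial>lborel)"
    by (subst nn_integral_cmult[symmetric]) (auto intro!: nn_integral_cong simp: indicator_def)
  also have "\<dots> = (\<integral>\<^sup>+t. (\<integral>\<^sup>+x. k x * (if 0 \<le> t \<and> ennreal t < h x then 1 else 0) \<partial>lborel) \<partial>lborel)"
    by (rule lborel_pair.Fubini'[symmetric]) measurable
  also have "\<dots> = (\<integral>\<^sup>+t. indicator {0..} t * (\<integral>\<^sup>+x. k x * indicator {x. ennreal t < h x} x \<partial>lborel) \<partial>lborel)"
    by (subst nn_integral_cmult[symmetric]) (auto intro!: nn_integral_cong simp: indicator_def)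
  finally show ?thesis by (simp add: cut)
qed

text \<open>
  The Hardy--Littlewood inequality in dual form. By the layer cake formula the left-hand side is an
  integral of \<open>\<nu>\<close>-measures of superlevel sets of \<open>\<phi>\<close>, and these are bounded by integrals of
  \<open>min (super_level_length h t) (super_level_length \<phi> s)\<close>. Replacing \<open>\<phi>\<close> by \<open>k\<close> increases them, and for the pair
  \<open>h\<close>, \<open>k\<close> the minimum is the length of the intersection of two nested intervals, which brings the
  integral of \<open>k * h\<close> back.
\<close>

lemma majorized_pairing:
  assumes \<nu>: "majorized \<nu> h" "sigma_finite_measure \<nu>" "sets \<nu> = sets borel"
    and h: "unimodal h" "\<And>x. h x \<le> ennreal b"
    and k: "unimodal k" "\<And>x. k x \<le> ennreal c"
    and [measurable]: "\<phi> \<in> borel_measurable borel"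
    and le: "\<And>t. t \<ge> 0 \<Longrightarrow> (\<integral>\<^sup>+x. (\<phi> x - ennreal t) \<partial>lborel) \<le> (\<integral>\<^sup>+x. (k x - ennreal t) \<partial>lborel)"
  shows "(\<integral>\<^sup>+x. \<phi> x \<partial>\<nu>) \<le> (\<integral>\<^sup>+x. k x * h x \<partial>lborel)"
proof -
  have [measurable]: "h \<in> borel_measurable borel" "k \<in> borel_measurable borel"
    using h k by auto
  have [measurable_cong]: "sets \<nu> = sets borel" by fact
  have sp: "space \<nu> = UNIV" using sets_eq_imp_space_eq[OF \<nu>(3)] by simp
  have "(\<integral>\<^sup>+x. \<phi> x \<partial>\<nu>) = (\<integral>\<^sup>+s. indicator {0..} s * emeasure \<nu> {x. ennreal s < \<phi> x} \<partial>lborel)"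
    using layer_cake[OF \<nu>(2), of \<phi> 0] by (simp add: sp)
  also have "\<dots> \<le> (\<integral>\<^sup>+s. indicator {0..} s *
      (\<integral>\<^sup>+t. indicator {0..} t * min (super_level_length h t) (super_level_length \<phi> s) \<partial>lborel) \<partial>lborel)"
    unfolding super_level_length_def[of \<phi>]
    by (intro nn_integral_mono mult_left_mono majorized_le_truncated_layers[OF \<nu>(1) h]) auto
  also have "\<dots> = (\<integral>\<^sup>+s. (\<integral>\<^sup>+t. indicator {0..} t * (indicator {0..} s * min (super_level_length \<phi> s) (super_level_length h t)) \<partial>lborel) \<partial>lborel)"
    by (subst nn_integral_cmult[symmetric]) (auto simp: ac_simps min.commute intro!: nn_integral_cong)
  also have "\<dots> = (\<integral>\<^sup>+t. (\<integral>\<^sup>+s. indicator {0..} t * (indicator {0..} s * min (super_level_length \<phi> s) (super_level_length h t)) \<partial>lborel) \<partial>lborel)"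
    by (rule lborel_pair.Fubini'[symmetric]) measurable
  also have "\<dots> = (\<integral>\<^sup>+t. indicator {0..} t * (\<integral>\<^sup>+s. indicator {0..} s * min (super_level_length \<phi> s) (super_level_length h t) \<partial>lborel) \<partial>lborel)"
    by (subst nn_integral_cmult) auto
  also have "\<dots> \<le> (\<integral>\<^sup>+t. indicator {0..} t * (\<integral>\<^sup>+s. indicator {0..} s * min (super_level_length k s) (super_level_length h t) \<partial>lborel) \<partial>lborel)"
  proof (rule nn_integral_mono, rule mult_left_mono, rule truncated_layers_mono[of _ _ c])
    show "(\<integral>\<^sup>+s. indicator {t..} s * super_level_length \<phi> s \<partial>lborel) \<le> (\<integral>\<^sup>+s. indicator {t..} s * super_level_length k s \<partial>lborel)"
      if "t \<ge> 0" for t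
      using le[OF that] that by (simp add: layer_cake_lborel)
  qed (auto intro: super_level_antimono super_level_eq_0[OF k(2)])
  also have "\<dots> = (\<integral>\<^sup>+x. k x * h x \<partial>lborel)"
    by (rule nn_integral_mult_unimodal[OF h(1) k(1), symmetric])
  finally show ?thesis .
qed

section \<open>Overlaps of two sets\<close>

lemma nn_integral_reflect:
  fixes f :: "real \<Rightarrow> ennreal"
  assumes "f \<in> borel_measurable borel"
  shows "(\<integral>\<^sup>+x. f x \<partial>lborel) = (\<integral>\<^sup>+x. f (c - x) \<partial>lborel)"
  using nn_integral_real_affine[OF assms, of "-1" c] by simp

lemma nn_integral_shift:
  fixes f :: "real \<Rightarrow> ennreal"
  assumes "f \<in> borel_measurable borel"
  shows "(\<integral>\<^sup>+x. f x \<partial>lborel) = (\<integral>\<^sup>+x. f (x + c) \<partial>lborel)"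
  using nn_integral_real_affine[OF assms, of 1 c] by (simp add: add.commute)

lemma ennreal_crossed_products_le:
  fixes a b c d :: ennreal
  assumes "b \<le> a" "d \<le> c"
  shows "a * d + b * c \<le> b * d + a * c"
proof -
  obtain e f where "a = b + e" "c = d + f" using assms by (metis le_iff_add)
  thus ?thesis by (auto simp: algebra_simps intro!: add_mono)
qed

text \<open>
  For \<open>0 \<le> y \<le> z\<close> reflect the half line above the midpoint \<open>m\<close> of \<open>y\<close> and \<open>z\<close> onto the one
  below. A point \<open>x < m\<close> is nearer to \<open>y\<close> than to \<open>z\<close>, and nearer to \<open>0\<close> than its mirror image is;
  so the values at \<open>y\<close> and \<open>z\<close> pair the same four numbers once in the same and once in the opposite
  order.
\<close>

lemma unimodal_correlation:
  assumes f: "unimodal f" and g: "unimodal g"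
  shows "unimodal (\<lambda>y. \<integral>\<^sup>+x. f (x + y) * g x \<partial>lborel)" (is "unimodal ?D")
proof -
  have [measurable]: "f \<in> borel_measurable borel" "g \<in> borel_measurable borel" using f g by auto
  have even: "?D (- y) = ?D y" for y
  proof -
    have "?D (- y) = (\<integral>\<^sup>+x. f ((0 - x) + - y) * g (0 - x) \<partial>lborel)"
      by (rule nn_integral_reflect) measurable
    also have "\<dots> = ?D y"
      using unimodal_even[OF f, of "x + y" for x] unimodal_even[OF g] by simp
    finally show ?thesis .
  qed
  have mono: "?D (- z) \<le> ?D (- y)" if yz: "0 \<le> y" "y \<le> z" for y z
  proof -
    define m where "m = (y + z) / 2"
    have fold: "?D (- w) = (\<integral>\<^sup>+x. indicator {..<m} x * (f (x - w') * g (y + z - x) + f (x - w) * g x) \<partial>lborel)"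
      if w: "w + w' = y + z" for w w'
    proof -
      have "?D (- w) = (\<integral>\<^sup>+x. indicator {..<m} x * (f (x - w) * g x) + indicator {m<..} x * (f (x - w) * g x) \<partial>lborel)"
      proof (rule nn_integral_cong_AE)
        show "AE x in lborel. f (x + - w) * g x =
            indicator {..<m} x * (f (x - w) * g x) + indicator {m<..} x * (f (x - w) * g x)"
          using AE_lborel_singleton[of m] by eventually_elim (auto simp: indicator_def)
      qed
      also have "\<dots> = (\<integral>\<^sup>+x. indicator {..<m} x * (f (x - w) * g x) \<partial>lborel)
          + (\<integral>\<^sup>+x. indicator {m<..} x * (f (x - w) * g x) \<partial>lborel)"
        by (rule nn_integral_add) measurable
      also have "(\<integral>\<^sup>+x. indicator {m<..} x * (f (x - w) * g x) \<partial>lborel)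
          = (\<integral>\<^sup>+x. indicator {m<..} (y + z - x) * (f (y + z - x - w) * g (y + z - x)) \<partial>lborel)"
        by (rule nn_integral_reflect) measurable
      also have "\<dots> = (\<integral>\<^sup>+x. indicator {..<m} x * (f (x - w') * g (y + z - x)) \<partial>lborel)"
      proof (intro nn_integral_cong)
        fix x
        have "y + z - x - w = - (x - w')" using w by simp
        hence "f (y + z - x - w) = f (x - w')" using unimodal_even[OF f] by metis
        thus "indicator {m<..} (y + z - x) * (f (y + z - x - w) * g (y + z - x))
            = indicator {..<m} x * (f (x - w') * g (y + z - x))"
          by (auto simp: indicator_def m_def field_simps)
      qed
      finally show ?thesis
        by (subst (asm) nn_integral_add[symmetric]) (auto simp: distrib_left add.commute)
    qed
    have "?D (- z) = (\<integral>\<^sup>+x. indicator {..<m} x * (f (x - y) * g (y + z - x) + f (x - z) * g x) \<partial>lborel)"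
      by (rule fold) simp
    also have "\<dots> \<le> (\<integral>\<^sup>+x. indicator {..<m} x * (f (x - z) * g (y + z - x) + f (x - y) * g x) \<partial>lborel)"
    proof (intro nn_integral_mono)
      fix x
      show "indicator {..<m} x * (f (x - y) * g (y + z - x) + f (x - z) * g x)
          \<le> indicator {..<m} x * (f (x - z) * g (y + z - x) + f (x - y) * g x)"
      proof (cases "x < m")
        case True
        have "f (x - z) \<le> f (x - y)" "g (y + z - x) \<le> g x"
          using True yz by (auto intro!: unimodalD[OF f] unimodalD[OF g] simp: m_def abs_if)
        thus ?thesis using True by (simp add: ennreal_crossed_products_le)
      qed simp
    qed
    also have "\<dots> = ?D (- y)" by (rule fold[symmetric]) simp
    finally show ?thesis .
  qed
  have "?D z \<le> ?D y" if "\<bar>y\<bar> \<le> \<bar>z\<bar>" for y z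
    using mono[of "\<bar>y\<bar>" "\<bar>z\<bar>"] that even by (auto simp: abs_if split: if_splits)
  thus ?thesis by (auto simp: unimodal_def)
qed

definition centred :: "real \<Rightarrow> real \<Rightarrow> ennreal" where
  "centred a = indicator {- a / 2..a / 2}"

lemma unimodal_centred: "unimodal (centred a)"
  unfolding unimodal_def centred_def by (auto simp: indicator_def)

lemma nn_integral_centred: "a \<ge> 0 \<Longrightarrow> (\<integral>\<^sup>+x. centred a x \<partial>lborel) = ennreal a"
  by (simp add: centred_def)

lemma ex_cut_point:
  assumes "finite_measure M" "sets M = sets borel" "\<And>x. measure M {x} = 0"
    and t: "0 < t" "t < measure M UNIV"
  obtains x :: real where "measure M {..x} = t"
proof -
  interpret finite_borel_measure M
    using assms(1,2) by (simp add: finite_borel_measure_def finite_borel_measure_axioms_def)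
  have "eventually (\<lambda>x. cdf M x < t) at_bot"
    using cdf_lim_at_bot t(1) by (rule order_tendstoD)
  then obtain lo where lo: "cdf M lo < t" by (metis eventually_happens trivial_limit_at_bot_linorder)
  have "eventually (\<lambda>x. t < cdf M x) at_top"
    using cdf_lim_at_top t(2) by (intro order_tendstoD) (auto simp: borel_UNIV)
  then obtain hi where hi: "t < cdf M hi" by (metis eventually_happens trivial_limit_at_top_linorder)
  have "lo \<le> hi" using cdf_nondecreasing[of hi lo] lo hi by linarith
  then obtain x where "cdf M x = t"
    using IVT'[of "cdf M" lo t hi] lo hi isCont_cdf assms(3)
    by (auto intro: continuous_at_imp_continuous_on)
  thus ?thesis by (intro that) (simp add: cdf_def2)
qed

lemma ex_cut_point_set:
  fixes A :: "real set"
  assumes [measurable]: "A \<in> sets borel" and fin: "emeasure lborel A < \<infinity>"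
    and t: "0 < t" "ennreal t < emeasure lborel A"
  obtains x where "emeasure lborel (A \<inter> {..x}) = ennreal t"
    "emeasure lborel (A \<inter> {x<..}) = emeasure lborel A - ennreal t"
proof -
  define M where "M = density lborel (indicator A)"
  have M: "emeasure M B = emeasure lborel (A \<inter> B)" if "B \<in> sets borel" for B
    unfolding M_def using that by (subst emeasure_density) (auto simp: indicator_inter_arith[symmetric] Int_commute)
  have fM: "finite_measure M"
    using fin M[of UNIV] by (intro finite_measureI) (auto simp: M_def)
  then interpret finite_measure M .
  have "emeasure lborel (A \<inter> {x}) \<le> emeasure lborel {x}" for x by (rule emeasure_mono) auto
  hence null: "measure M {x} = 0" for x using M[of "{x}"] by (simp add: measure_def)
  have "t < measure M UNIV"
    using t M[of UNIV] emeasure_eq_measure[of UNIV] ennreal_less_iff[of t "measure M UNIV"] by simp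
  then obtain x where x: "measure M {..x} = t"
    using ex_cut_point[OF fM _ null t(1)] by (auto simp: M_def)
  hence 1: "emeasure lborel (A \<inter> {..x}) = ennreal t"
    using M[of "{..x}"] by (simp add: emeasure_eq_measure)
  have "A \<inter> {x<..} = A - A \<inter> {..x}" by auto
  hence "emeasure lborel (A \<inter> {x<..}) = emeasure lborel A - ennreal t"
    using 1 by (simp add: emeasure_Diff)
  thus ?thesis using 1 by (rule_tac that)
qed

lemma nn_integral_overlap:
  fixes A C :: "real set"
  assumes "sigma_finite_measure M" and [measurable_cong]: "sets M = sets borel"
    and [measurable]: "A \<in> sets borel" "C \<in> sets borel"
  shows "(\<integral>\<^sup>+y. emeasure lborel {x\<in>A. x + y \<in> C} \<partial>M) = (\<integral>\<^sup>+x. indicator A x * emeasure M {y. x + y \<in> C} \<partial>lborel)"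
proof -
  interpret M: sigma_finite_measure M by fact
  interpret P: pair_sigma_finite lborel M ..
  have sp: "space M = UNIV" using sets_eq_imp_space_eq[OF assms(2)] by simp
  have "(\<integral>\<^sup>+y. emeasure lborel {x\<in>A. x + y \<in> C} \<partial>M) = (\<integral>\<^sup>+y. (\<integral>\<^sup>+x. indicator A x * indicator C (x + y) \<partial>lborel) \<partial>M)"
  proof (intro nn_integral_cong)
    fix y
    have "emeasure lborel {x\<in>A. x + y \<in> C} = (\<integral>\<^sup>+x. indicator {x\<in>A. x + y \<in> C} x \<partial>lborel)"
      by (rule nn_integral_indicator[symmetric]) measurable
    also have "\<dots> = (\<integral>\<^sup>+x. indicator A x * indicator C (x + y) \<partial>lborel)"
      by (intro nn_integral_cong) (auto simp: indicator_def)
    finally show "emeasure lborel {x\<in>A. x + y \<in> C} = (\<integral>\<^sup>+x. indicator A x * indicator C (x + y) \<partial>lborel)" .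
  qed
  also have "\<dots> = (\<integral>\<^sup>+x. (\<integral>\<^sup>+y. indicator A x * indicator C (x + y) \<partial>M) \<partial>lborel)"
    by (rule P.Fubini') measurable
  also have "\<dots> = (\<integral>\<^sup>+x. indicator A x * emeasure M {y. x + y \<in> C} \<partial>lborel)"
  proof (intro nn_integral_cong)
    fix x
    have [measurable]: "{y. x + y \<in> C} \<in> sets M" by measurable
    have "(\<integral>\<^sup>+y. indicator A x * indicator C (x + y) \<partial>M)
        = (\<integral>\<^sup>+y. indicator A x * indicator {y. x + y \<in> C} y \<partial>M)"
      by (intro nn_integral_cong) (simp add: indicator_def)
    also have "\<dots> = indicator A x * emeasure M {y. x + y \<in> C}"
      by (rule nn_integral_cmult_indicator) measurable
    finally show "(\<integral>\<^sup>+y. indicator A x * indicator C (x + y) \<partial>M) = indicator A x * emeasure M {y. x + y \<in> C}" .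
  qed
  finally show ?thesis .
qed

lemma emeasure_lborel_shift:
  fixes C :: "real set"
  assumes [measurable]: "C \<in> sets borel"
  shows "emeasure lborel {y. x + y \<in> C} = emeasure lborel C"
proof -
  have "emeasure lborel C = (\<integral>\<^sup>+y. indicator C (y + x) \<partial>lborel)"
    using nn_integral_shift[of "indicator C" x] by simp
  also have "\<dots> = (\<integral>\<^sup>+y. indicator {y. x + y \<in> C} y \<partial>lborel)"
    by (intro nn_integral_cong) (auto simp: indicator_def add.commute)
  finally show ?thesis by simp
qed

lemma nn_integral_overlap_lborel:
  fixes A C :: "real set"
  assumes [measurable]: "A \<in> sets borel" "C \<in> sets borel"
  shows "(\<integral>\<^sup>+y. emeasure lborel {x\<in>A. x + y \<in> C} \<partial>lborel) = emeasure lborel A * emeasure lborel C"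
  using nn_integral_overlap[of lborel A C] assms
  by (simp add: lborel.sigma_finite_measure_axioms emeasure_lborel_shift nn_integral_multc mult.commute)

text \<open>
  The core of Riesz's rearrangement inequality. Cut off from \<open>A\<close> and from \<open>C\<close> the lowest part of
  measure \<open>t\<close>, at points \<open>a\<close> and \<open>c\<close>. For fixed \<open>y\<close> the points \<open>x\<close> of the overlap with \<open>x \<le> a\<close>
  and those with \<open>x + y \<le> c\<close> both form initial segments, so one of the two sets contains the other:
  removing the two low parts costs an overlap at most \<open>t\<close>, not \<open>2 t\<close>. What remains integrates to the
  product of the remaining lengths.
\<close>

lemma overlap_excess_le:
  fixes A C :: "real set"
  assumes A[measurable]: "A \<in> sets borel" and C[measurable]: "C \<in> sets borel"
    and fin: "emeasure lborel A < \<infinity>" "emeasure lborel C < \<infinity>" and "t \<ge> 0"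
  shows "(\<integral>\<^sup>+y. (emeasure lborel {x\<in>A. x + y \<in> C} - ennreal t) \<partial>lborel)
    \<le> (emeasure lborel A - ennreal t) * (emeasure lborel C - ennreal t)"
proof -
  have leA: "emeasure lborel {x\<in>A. x + y \<in> C} \<le> emeasure lborel A" for y
    by (rule emeasure_mono) auto
  have "emeasure lborel {x\<in>A. x + y \<in> C} \<le> emeasure lborel {x. y + x \<in> C}" for y
    by (rule emeasure_mono) (auto simp: add.commute)
  hence leC: "emeasure lborel {x\<in>A. x + y \<in> C} \<le> emeasure lborel C" for y
    by (simp add: emeasure_lborel_shift)
  consider "t = 0" | "emeasure lborel A \<le> ennreal t" | "emeasure lborel C \<le> ennreal t"
    | "0 < t" "ennreal t < emeasure lborel A" "ennreal t < emeasure lborel C"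
    using \<open>t \<ge> 0\<close> by force
  thus ?thesis
  proof cases
    case 1
    thus ?thesis by (simp add: nn_integral_overlap_lborel)
  next
    case 2
    hence "emeasure lborel {x\<in>A. x + y \<in> C} - ennreal t = 0" for y
      using leA[of y] by (intro ennreal_excess_eq_0) (rule order_trans)
    thus ?thesis by simp
  next
    case 3
    hence "emeasure lborel {x\<in>A. x + y \<in> C} - ennreal t = 0" for y
      using leC[of y] by (intro ennreal_excess_eq_0) (rule order_trans)
    thus ?thesis by simp
  next
    case 4
    obtain a where a: "emeasure lborel (A \<inter> {..a}) = ennreal t"
      "emeasure lborel (A \<inter> {a<..}) = emeasure lborel A - ennreal t"
      using ex_cut_point_set[OF A fin(1) 4(1,2)] .
    obtain c where c: "emeasure lborel (C \<inter> {..c}) = ennreal t"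
      "emeasure lborel (C \<inter> {c<..}) = emeasure lborel C - ennreal t"
      using ex_cut_point_set[OF C fin(2) 4(1,3)] .
    have "emeasure lborel {x\<in>A. x + y \<in> C} - ennreal t
        \<le> emeasure lborel {x\<in>A \<inter> {a<..}. x + y \<in> C \<inter> {c<..}}" (is "?p y - _ \<le> ?q y") for y
    proof -
      have "\<exists>R\<in>sets borel. emeasure lborel R = ennreal t \<and>
          {x\<in>A. x + y \<in> C} \<subseteq> R \<union> {x\<in>A \<inter> {a<..}. x + y \<in> C \<inter> {c<..}}"
        \<comment> \<open>\<open>x + y \<le> c\<close> means \<open>x \<le> c - y\<close>, so the smaller of \<open>a\<close> and \<open>c - y\<close> can be ignored\<close>
      proof (cases "c - y \<le> a")
        case True
        thus ?thesis using a(1) by (intro bexI[of _ "A \<inter> {..a}"]) auto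
      next
        case False
        have "emeasure lborel {x. y + x \<in> C \<inter> {..c}} = ennreal t"
          using c(1) by (subst emeasure_lborel_shift) auto
        thus ?thesis using False
          by (intro bexI[of _ "{x. y + x \<in> C \<inter> {..c}}"]) (auto simp: add.commute)
      qed
      then obtain R where R: "R \<in> sets borel" "emeasure lborel R = ennreal t"
          "{x\<in>A. x + y \<in> C} \<subseteq> R \<union> {x\<in>A \<inter> {a<..}. x + y \<in> C \<inter> {c<..}}" by blast
      have "?p y \<le> emeasure lborel (R \<union> {x\<in>A \<inter> {a<..}. x + y \<in> C \<inter> {c<..}})"
        using R by (intro emeasure_mono) auto
      also have "\<dots> \<le> ennreal t + ?q y"
        unfolding R(2)[symmetric] using R(1) by (intro emeasure_subadditive) auto
      finally show ?thesis
        by (simp add: ennreal_minus_le_iff)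
    qed
    hence "(\<integral>\<^sup>+y. (?p y - ennreal t) \<partial>lborel) \<le> (\<integral>\<^sup>+y. ?q y \<partial>lborel)"
      by (intro nn_integral_mono)
    also have "\<dots> = (emeasure lborel A - ennreal t) * (emeasure lborel C - ennreal t)"
      by (subst nn_integral_overlap_lborel) (auto simp: a c)
    finally show ?thesis .
  qed
qed

lemma centred_overlap:
  "(\<integral>\<^sup>+x. centred c (x + y) * centred a x \<partial>lborel)
    = emeasure lborel {max (- a / 2) (- c / 2 - y)..min (a / 2) (c / 2 - y)}"
proof -
  have "(\<integral>\<^sup>+x. centred c (x + y) * centred a x \<partial>lborel)
      = (\<integral>\<^sup>+x. indicator {max (- a / 2) (- c / 2 - y)..min (a / 2) (c / 2 - y)} x \<partial>lborel)"
    by (intro nn_integral_cong) (auto simp: centred_def indicator_def)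
  thus ?thesis by simp
qed

text \<open>
  Shortening both centred intervals by \<open>t\<close> shortens each of their overlaps by \<open>t\<close> as long as it does
  not become empty, so centred intervals attain the bound for overlaps of arbitrary sets.
\<close>

lemma centred_overlap_excess_ge:
  assumes "a \<ge> 0" "c \<ge> 0" "t \<ge> 0"
  shows "(ennreal a - ennreal t) * (ennreal c - ennreal t)
    \<le> (\<integral>\<^sup>+y. ((\<integral>\<^sup>+x. centred c (x + y) * centred a x \<partial>lborel) - ennreal t) \<partial>lborel)"
proof (cases "t \<le> a \<and> t \<le> c")
  case False
  hence "ennreal a - ennreal t = 0 \<or> ennreal c - ennreal t = 0"
    using assms by (auto simp: diff_eq_0_iff_ennreal intro!: ennreal_leI)
  thus ?thesis by auto
next
  case True
  let ?I = "\<lambda>a c y. {max (- a / 2) (- c / 2 - y)..min (a / 2) (c / 2 - y)} :: real set"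
  have I: "{x\<in>{- a / 2..a / 2}. x + y \<in> {- c / 2..c / 2}} = ?I a c y" for a c y :: real
    by auto
  have "(ennreal a - ennreal t) * (ennreal c - ennreal t)
      = emeasure lborel {- (a - t) / 2..(a - t) / 2} * emeasure lborel {- (c - t) / 2..(c - t) / 2}"
    using True assms nn_integral_centred[of "a - t"] nn_integral_centred[of "c - t"]
    by (simp add: ennreal_minus centred_def)
  also have "\<dots> = (\<integral>\<^sup>+y. emeasure lborel (?I (a - t) (c - t) y) \<partial>lborel)"
    using nn_integral_overlap_lborel[of "{- (a - t) / 2..(a - t) / 2}" "{- (c - t) / 2..(c - t) / 2}"]
    unfolding I by simp
  also have "\<dots> \<le> (\<integral>\<^sup>+y. (emeasure lborel (?I a c y) - ennreal t) \<partial>lborel)"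
  proof (intro nn_integral_mono)
    fix y :: real
    define lo where "lo = max (- a / 2) (- c / 2 - y)"
    define hi where "hi = min (a / 2) (c / 2 - y)"
    have "max (- (a - t) / 2) (- (c - t) / 2 - y) = lo + t / 2" "min ((a - t) / 2) ((c - t) / 2 - y) = hi - t / 2"
      by (auto simp: lo_def hi_def max_def min_def field_simps)
    hence 1: "?I (a - t) (c - t) y = {lo + t / 2..hi - t / 2}" by simp
    show "emeasure lborel (?I (a - t) (c - t) y) \<le> emeasure lborel (?I a c y) - ennreal t"
      unfolding 1 lo_def[symmetric] hi_def[symmetric]
      using \<open>t \<ge> 0\<close> by (cases "lo + t / 2 \<le> hi - t / 2") (auto simp: ennreal_minus)
  qed
  finally show ?thesis by (simp add: centred_overlap)
qed

section \<open>Riesz's inequality for convolutions of measures\<close>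

lemma overlap_majorized:
  fixes A C :: "real set"
  assumes "A \<in> sets borel" "C \<in> sets borel"
    and "emeasure lborel A = ennreal a" "emeasure lborel C = ennreal c" "a \<ge> 0" "c \<ge> 0" "t \<ge> 0"
  shows "(\<integral>\<^sup>+y. (emeasure lborel {x\<in>A. x + y \<in> C} - ennreal t) \<partial>lborel)
    \<le> (\<integral>\<^sup>+y. ((\<integral>\<^sup>+x. centred c (x + y) * centred a x \<partial>lborel) - ennreal t) \<partial>lborel)"
  using overlap_excess_le[of A C t] centred_overlap_excess_ge[of a c t] assms by simp

lemma ennreal_le_excess: "(x :: ennreal) \<le> t + (x - t)"
  by (simp add: add_diff_self_ennreal not_le less_imp_le)

lemma nn_integral_centred_le:
  assumes [measurable]: "f \<in> borel_measurable borel" and "a \<ge> 0"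
  shows "(\<integral>\<^sup>+x. centred a x * f x \<partial>lborel) \<le> ennreal t * ennreal a + (\<integral>\<^sup>+x. (f x - ennreal t) \<partial>lborel)"
proof -
  have [measurable]: "centred a \<in> borel_measurable borel" by (simp add: centred_def)
  have "(\<integral>\<^sup>+x. centred a x * f x \<partial>lborel) \<le> (\<integral>\<^sup>+x. ennreal t * centred a x + (f x - ennreal t) \<partial>lborel)"
    using ennreal_le_excess by (intro nn_integral_mono) (auto simp: centred_def indicator_def)
  also have "\<dots> = ennreal t * ennreal a + (\<integral>\<^sup>+x. (f x - ennreal t) \<partial>lborel)"
    using assms(2) by (simp add: nn_integral_add nn_integral_cmult nn_integral_centred)
  finally show ?thesis .
qed

text \<open>
  The function \<open>K\<close> of \<open>x\<close> on the left is tested on its superlevel set \<open>A\<close> at level \<open>t\<close>. Its integral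
  over \<open>A\<close> is a \<open>\<nu>\<close>-integral of overlaps of \<open>A\<close> and \<open>S\<close>; the bounds for overlaps and for \<open>\<nu>\<close> replace
  \<open>A\<close>, \<open>S\<close> and \<open>\<nu>\<close> by centred intervals and \<open>h\<close>, and then the contribution \<open>t * emeasure lborel A\<close>
  cancels. At \<open>t = 0\<close>, where \<open>A\<close> may have infinite length, total masses are compared instead.
\<close>

lemma slice_majorized:
  fixes S :: "real set"
  assumes \<nu>: "majorized \<nu> h" "finite_measure \<nu>" "sets \<nu> = sets borel"
    and h: "unimodal h" "\<And>x. h x \<le> ennreal b"
    and S[measurable]: "S \<in> sets borel" and s: "emeasure lborel S = ennreal s" "s \<ge> 0" and "t \<ge> 0"
  shows "(\<integral>\<^sup>+x. (emeasure \<nu> {y. x + y \<in> S} - ennreal t) \<partial>lborel)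
    \<le> (\<integral>\<^sup>+x. ((\<integral>\<^sup>+y. centred s (y + x) * h y \<partial>lborel) - ennreal t) \<partial>lborel)"
proof -
  interpret finite_measure \<nu> by fact
  interpret P: pair_sigma_finite lborel \<nu> ..
  have [measurable]: "h \<in> borel_measurable borel" using h by auto
  have [measurable_cong]: "sets \<nu> = sets borel" by fact
  have sp: "space \<nu> = UNIV" using sets_eq_imp_space_eq[OF \<nu>(3)] by simp
  have [measurable]: "centred a \<in> borel_measurable borel" for a by (simp add: centred_def)
  define K where "K x = emeasure \<nu> {y. x + y \<in> S}" for x
  have K: "K x = (\<integral>\<^sup>+y. indicator S (x + y) \<partial>\<nu>)" for x
  proof -
    have "{y. x + y \<in> S} \<in> sets \<nu>" by measurable
    hence "K x = (\<integral>\<^sup>+y. indicator {y. x + y \<in> S} y \<partial>\<nu>)" by (simp add: K_def)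
    thus ?thesis by (simp add: indicator_def)
  qed
  have [measurable]: "K \<in> borel_measurable borel" unfolding K[abs_def] by measurable
  define k where "k x = (\<integral>\<^sup>+y. centred s (y + x) * h y \<partial>lborel)" for x
  have [measurable]: "k \<in> borel_measurable borel" unfolding k_def[abs_def] by measurable
  have mass: "emeasure \<nu> UNIV \<le> (\<integral>\<^sup>+x. h x \<partial>lborel)"
    using \<nu>(1)[unfolded majorized_def, rule_format, of UNIV 0] by simp
  have K_mass: "(\<integral>\<^sup>+x. K x \<partial>lborel) = ennreal s * emeasure \<nu> UNIV"
  proof -
    have "(\<integral>\<^sup>+x. K x \<partial>lborel) = (\<integral>\<^sup>+y. emeasure lborel {x\<in>UNIV. x + y \<in> S} \<partial>\<nu>)"
      unfolding K_def using nn_integral_overlap[of \<nu> UNIV S] sigma_finite_measure_axioms \<nu>(3) by simp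
    also have "\<dots> = (\<integral>\<^sup>+y. ennreal s \<partial>\<nu>)"
      using emeasure_lborel_shift[OF S] s by (intro nn_integral_cong) (simp add: add.commute)
    finally show ?thesis by (simp add: sp)
  qed
  have k_mass: "(\<integral>\<^sup>+x. k x \<partial>lborel) = ennreal s * (\<integral>\<^sup>+x. h x \<partial>lborel)"
  proof -
    have "(\<integral>\<^sup>+x. k x \<partial>lborel) = (\<integral>\<^sup>+y. (\<integral>\<^sup>+x. centred s (y + x) * h y \<partial>lborel) \<partial>lborel)"
      unfolding k_def by (rule lborel_pair.Fubini') measurable
    also have "\<dots> = (\<integral>\<^sup>+y. ennreal s * h y \<partial>lborel)"
    proof (intro nn_integral_cong)
      fix y
      have "(\<integral>\<^sup>+x. centred s (y + x) * h y \<partial>lborel) = (\<integral>\<^sup>+x. centred s (x + y) \<partial>lborel) * h y"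
        by (subst nn_integral_multc) (auto simp: add.commute)
      also have "(\<integral>\<^sup>+x. centred s (x + y) \<partial>lborel) = ennreal s"
        using nn_integral_shift[of "centred s" y] nn_integral_centred[OF s(2)] by simp
      finally show "(\<integral>\<^sup>+x. centred s (y + x) * h y \<partial>lborel) = ennreal s * h y" .
    qed
    finally show ?thesis by (simp add: nn_integral_cmult)
  qed
  have "(\<integral>\<^sup>+x. (K x - ennreal t) \<partial>lborel) \<le> (\<integral>\<^sup>+x. (k x - ennreal t) \<partial>lborel)"
  proof (cases "t = 0")
    case True
    thus ?thesis using mass by (simp add: K_mass k_mass mult_left_mono)
  next
    case False
    define A where "A = {x. ennreal t < K x}"
    have [measurable]: "A \<in> sets borel" unfolding A_def by measurable
    have split: "(\<integral>\<^sup>+x. indicator A x * K x \<partial>lborel) = ennreal t * emeasure lborel A + (\<integral>\<^sup>+x. (K x - ennreal t) \<partial>lborel)"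
    proof -
      have "(\<integral>\<^sup>+x. indicator A x * K x \<partial>lborel) = (\<integral>\<^sup>+x. ennreal t * indicator A x + (K x - ennreal t) \<partial>lborel)"
        by (intro nn_integral_cong) (auto simp: A_def indicator_def ennreal_excess_eq_0 not_less add_diff_inverse_ennreal)
      thus ?thesis by (simp add: nn_integral_add nn_integral_cmult)
    qed
    have "ennreal t * emeasure lborel A \<le> (\<integral>\<^sup>+x. K x \<partial>lborel)"
      by (subst nn_integral_cmult_indicator[symmetric])
         (auto intro!: nn_integral_mono simp: A_def indicator_def)
    also have "\<dots> < \<infinity>" by (simp add: K_mass emeasure_eq_measure ennreal_mult_less_top)
    finally have "emeasure lborel A < \<infinity>" using False \<open>t \<ge> 0\<close> by (auto simp: ennreal_mult_less_top)
    then obtain a where a: "emeasure lborel A = ennreal a" "a \<ge> 0"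
      by (cases "emeasure lborel A") auto
    define k' where "k' y = (\<integral>\<^sup>+x. centred s (x + y) * centred a x \<partial>lborel)" for y
    have [measurable]: "k' \<in> borel_measurable borel" unfolding k'_def[abs_def] by measurable
    have "(\<integral>\<^sup>+x. indicator A x * K x \<partial>lborel) = (\<integral>\<^sup>+y. emeasure lborel {x\<in>A. x + y \<in> S} \<partial>\<nu>)"
      unfolding K_def by (subst nn_integral_overlap) (auto simp: sigma_finite_measure_axioms \<nu>(3))
    also have "\<dots> \<le> (\<integral>\<^sup>+y. k' y * h y \<partial>lborel)"
    proof (rule majorized_pairing[OF \<nu>(1) sigma_finite_measure_axioms \<nu>(3) h])
      show "unimodal k'" unfolding k'_def by (intro unimodal_correlation unimodal_centred)
      show "k' y \<le> ennreal a" for y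
      proof -
        have "k' y \<le> (\<integral>\<^sup>+x. centred a x \<partial>lborel)"
          unfolding k'_def by (intro nn_integral_mono) (auto simp: centred_def indicator_def)
        thus ?thesis using a by (simp add: nn_integral_centred)
      qed
      show "(\<lambda>y. emeasure lborel {x\<in>A. x + y \<in> S}) \<in> borel_measurable borel"
      proof -
        have "(\<lambda>y. \<integral>\<^sup>+x. indicator A x * indicator S (x + y) \<partial>lborel) \<in> borel_measurable borel"
          by measurable
        also have "(\<lambda>y. \<integral>\<^sup>+x. indicator A x * indicator S (x + y) \<partial>lborel)
            = (\<lambda>y. \<integral>\<^sup>+x. indicator {x\<in>A. x + y \<in> S} x \<partial>lborel)"
          by (intro ext nn_integral_cong) (auto simp: indicator_def)
        also have "\<dots> = (\<lambda>y. emeasure lborel {x\<in>A. x + y \<in> S})"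
          by (intro ext nn_integral_indicator) measurable
        finally show ?thesis .
      qed
      show "(\<integral>\<^sup>+y. (emeasure lborel {x\<in>A. x + y \<in> S} - ennreal t) \<partial>lborel)
          \<le> (\<integral>\<^sup>+y. (k' y - ennreal t) \<partial>lborel)" if "t \<ge> 0" for t
        unfolding k'_def using a s that by (intro overlap_majorized) auto
    qed
    also have "\<dots> = (\<integral>\<^sup>+y. (\<integral>\<^sup>+x. centred s (x + y) * centred a x * h y \<partial>lborel) \<partial>lborel)"
      unfolding k'_def by (subst nn_integral_multc) auto
    also have "\<dots> = (\<integral>\<^sup>+x. (\<integral>\<^sup>+y. centred s (x + y) * centred a x * h y \<partial>lborel) \<partial>lborel)"
      by (rule lborel_pair.Fubini') measurable
    also have "\<dots> = (\<integral>\<^sup>+x. centred a x * k x \<partial>lborel)"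
      unfolding k_def by (subst nn_integral_cmult[symmetric]) (auto intro!: nn_integral_cong simp: ac_simps)
    also have "\<dots> \<le> ennreal t * ennreal a + (\<integral>\<^sup>+x. (k x - ennreal t) \<partial>lborel)"
      using a by (intro nn_integral_centred_le) auto
    finally show ?thesis
      unfolding split a(1) by (simp add: ennreal_mult[symmetric] a(2) \<open>t \<ge> 0\<close>)
  qed
  thus ?thesis by (simp add: K_def k_def)
qed

text \<open>
  Riesz's inequality for measures. The measure of \<open>S\<close> under the convolution is the \<open>\<nu>\<close>-integral of
  the slices \<open>emeasure \<nu>' {y. x + y \<in> S}\<close>, which are controlled by the preceding lemma, so the
  pairing with \<open>\<nu>\<close> bounds it by the integral of the convolved densities over the centred interval
  of the length of \<open>S\<close>.
\<close>

lemma majorized_convolution: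
  assumes \<nu>: "majorized \<nu> h" "finite_measure \<nu>" "sets \<nu> = sets borel"
    and \<nu>': "majorized \<nu>' h'" "finite_measure \<nu>'" "sets \<nu>' = sets borel"
    and h: "unimodal h" "\<And>x. h x \<le> ennreal b"
    and h': "unimodal h'" "\<And>x. h' x \<le> ennreal b'"
  shows "majorized (\<nu> \<star> \<nu>') (\<lambda>z. \<integral>\<^sup>+y. h (z - y) * h' y \<partial>lborel)" (is "majorized _ ?f")
proof -
  interpret \<nu>: finite_measure \<nu> by fact
  have [measurable]: "h \<in> borel_measurable borel" "h' \<in> borel_measurable borel" using h h' by auto
  have [measurable]: "centred a \<in> borel_measurable borel" for a by (simp add: centred_def)
  have [measurable]: "?f \<in> borel_measurable borel" by measurable
  have sp: "space \<nu> = UNIV" "space \<nu>' = UNIV"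
    using sets_eq_imp_space_eq[OF \<nu>(3)] sets_eq_imp_space_eq[OF \<nu>'(3)] by simp_all
  have conv: "emeasure (\<nu> \<star> \<nu>') S = (\<integral>\<^sup>+x. emeasure \<nu>' {y. x + y \<in> S} \<partial>\<nu>)" if "S \<in> sets borel" for S
    using convolution_emeasure[OF that \<nu>(2) \<nu>'(2) \<nu>'(3) \<nu>(3)] sp by (simp add: add.commute)
  have mass: "emeasure \<nu> UNIV \<le> (\<integral>\<^sup>+x. h x \<partial>lborel)" "emeasure \<nu>' UNIV \<le> (\<integral>\<^sup>+x. h' x \<partial>lborel)"
    using \<nu>(1)[unfolded majorized_def, rule_format, of UNIV 0]
      \<nu>'(1)[unfolded majorized_def, rule_format, of UNIV 0] by simp_all
  have unfold: "(\<integral>\<^sup>+z. g z * ?f z \<partial>lborel) = (\<integral>\<^sup>+x. (\<integral>\<^sup>+y. g (y + x) * h' y \<partial>lborel) * h x \<partial>lborel)"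
    if [measurable]: "g \<in> borel_measurable borel" for g
  proof -
    have "(\<integral>\<^sup>+z. g z * ?f z \<partial>lborel) = (\<integral>\<^sup>+z. (\<integral>\<^sup>+y. g z * (h (z - y) * h' y) \<partial>lborel) \<partial>lborel)"
      by (subst nn_integral_cmult) auto
    also have "\<dots> = (\<integral>\<^sup>+y. (\<integral>\<^sup>+z. g z * (h (z - y) * h' y) \<partial>lborel) \<partial>lborel)"
      by (rule lborel_pair.Fubini') measurable
    also have "\<dots> = (\<integral>\<^sup>+y. (\<integral>\<^sup>+x. g (x + y) * (h (x + y - y) * h' y) \<partial>lborel) \<partial>lborel)"
      by (intro nn_integral_cong nn_integral_shift) measurable
    also have "\<dots> = (\<integral>\<^sup>+x. (\<integral>\<^sup>+y. g (x + y) * (h (x + y - y) * h' y) \<partial>lborel) \<partial>lborel)"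
      by (rule lborel_pair.Fubini') measurable
    also have "\<dots> = (\<integral>\<^sup>+x. (\<integral>\<^sup>+y. g (y + x) * h' y \<partial>lborel) * h x \<partial>lborel)"
      by (subst nn_integral_multc[symmetric]) (auto intro!: nn_integral_cong simp: ac_simps)
    finally show ?thesis .
  qed
  have total: "emeasure (\<nu> \<star> \<nu>') S \<le> (\<integral>\<^sup>+z. ?f z \<partial>lborel)" if S: "S \<in> sets borel" for S
  proof -
    have "emeasure (\<nu> \<star> \<nu>') S \<le> (\<integral>\<^sup>+x. emeasure \<nu>' UNIV \<partial>\<nu>)"
      unfolding conv[OF S] by (intro nn_integral_mono emeasure_mono) (auto simp: \<nu>'(3))
    also have "\<dots> = emeasure \<nu>' UNIV * emeasure \<nu> UNIV" by (simp add: sp)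
    also have "\<dots> \<le> (\<integral>\<^sup>+x. h' x \<partial>lborel) * (\<integral>\<^sup>+x. h x \<partial>lborel)"
      by (intro mult_mono mass) auto
    also have "\<dots> = (\<integral>\<^sup>+z. 1 * ?f z \<partial>lborel)"
      by (subst unfold) (auto simp: nn_integral_cmult)
    finally show ?thesis by simp
  qed
  show ?thesis unfolding majorized_def
  proof (intro ballI allI impI)
    fix S :: "real set" and t :: real
    assume S[measurable]: "S \<in> sets borel" and t: "t \<ge> 0"
    show "emeasure (\<nu> \<star> \<nu>') S \<le> ennreal t * emeasure lborel S + (\<integral>\<^sup>+z. (?f z - ennreal t) \<partial>lborel)"
    proof (cases "emeasure lborel S")
      case top
      show ?thesis
      proof (cases "t = 0")
        case True
        thus ?thesis using total[OF S] by simp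
      next
        case False
        thus ?thesis using top t by (simp add: ennreal_mult_top)
      qed
    next
      case (real s)
      define k where "k x = (\<integral>\<^sup>+y. centred s (y + x) * h' y \<partial>lborel)" for x
      have "emeasure (\<nu> \<star> \<nu>') S = (\<integral>\<^sup>+x. emeasure \<nu>' {y. x + y \<in> S} \<partial>\<nu>)" by (rule conv) fact
      also have "\<dots> \<le> (\<integral>\<^sup>+x. k x * h x \<partial>lborel)"
      proof (rule majorized_pairing[OF \<nu>(1) _ \<nu>(3) h])
        show "sigma_finite_measure \<nu>" by (rule \<nu>.sigma_finite_measure_axioms)
        show "unimodal k" unfolding k_def by (intro unimodal_correlation unimodal_centred h')
        show "k x \<le> ennreal (s * b')" for x
        proof -
          have "k x \<le> (\<integral>\<^sup>+y. centred s (y + x) * ennreal b' \<partial>lborel)"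
            unfolding k_def by (intro nn_integral_mono mult_left_mono h') auto
          also have "\<dots> = (\<integral>\<^sup>+y. centred s (y + x) \<partial>lborel) * ennreal b'"
            by (rule nn_integral_multc) measurable
          also have "(\<integral>\<^sup>+y. centred s (y + x) \<partial>lborel) = ennreal s"
            using nn_integral_shift[of "centred s" x] nn_integral_centred[OF real(1)] by simp
          finally show ?thesis using real(1) by (simp add: ennreal_mult')
        qed
        interpret \<nu>': finite_measure \<nu>' by fact
        have [measurable_cong]: "sets \<nu>' = sets borel" by fact
        have "emeasure \<nu>' {y. x + y \<in> S} = (\<integral>\<^sup>+y. indicator S (x + y) \<partial>\<nu>')" for x
        proof -
          have "{y. x + y \<in> S} \<in> sets \<nu>'" by measurable
          hence "emeasure \<nu>' {y. x + y \<in> S} = (\<integral>\<^sup>+y. indicator {y. x + y \<in> S} y \<partial>\<nu>')" by simp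
          thus ?thesis by (simp add: indicator_def)
        qed
        thus "(\<lambda>x. emeasure \<nu>' {y. x + y \<in> S}) \<in> borel_measurable borel" by simp
        show "(\<integral>\<^sup>+x. (emeasure \<nu>' {y. x + y \<in> S} - ennreal t) \<partial>lborel) \<le> (\<integral>\<^sup>+x. (k x - ennreal t) \<partial>lborel)"
          if "t \<ge> 0" for t
          unfolding k_def using slice_majorized[OF \<nu>' h' S] real that by auto
      qed
      also have "\<dots> = (\<integral>\<^sup>+z. centred s z * ?f z \<partial>lborel)"
        unfolding k_def by (rule unfold[symmetric]) measurable
      also have "\<dots> \<le> ennreal t * ennreal s + (\<integral>\<^sup>+z. (?f z - ennreal t) \<partial>lborel)"
        by (rule nn_integral_centred_le) (auto simp: real)
      finally show ?thesis using real by simp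
    qed
  qed
qed

text \<open>
  At the level \<open>t = h 0\<close> the excess of \<open>h\<close> vanishes.
\<close>

lemma majorized_density_bound:
  assumes "majorized \<nu> h" "unimodal h" "h 0 = ennreal a" "a \<ge> 0" "S \<in> sets borel"
  shows "emeasure \<nu> S \<le> ennreal a * emeasure lborel S"
proof -
  have "h x - ennreal a = 0" for x
    using unimodalD[OF assms(2), of 0 x] assms(3) by (intro ennreal_excess_eq_0) simp
  thus ?thesis using assms(1)[unfolded majorized_def, rule_format, OF assms(5,4)] by simp
qed

section \<open>Convolution powers of the triangle and sums of independent variables\<close>

lemma p2_nonneg: "0 \<le> p2 x" by (simp add: p2_def)
lemma p2_le: "p2 x \<le> 2 * indicator {- 1 / 2..1 / 2} x"
  by (auto simp: p2_def indicator_def max_def abs_if field_simps split: if_splits)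
lemma p2_measurable [measurable]: "p2 \<in> borel_measurable borel"
  unfolding p2_def[abs_def] by measurable

lemma unimodal_p2: "unimodal (\<lambda>x. ennreal (p2 x))"
  unfolding unimodal_def by (auto simp: p2_def intro!: ennreal_leI)

lemma unimodal_convolution:
  assumes "unimodal f" "unimodal g"
  shows "unimodal (\<lambda>x. \<integral>\<^sup>+y. f (x - y) * g y \<partial>lborel)"
proof -
  have "f (x - y) = f (y + - x)" for x y
    using unimodal_even[OF assms(1), of "x - y"] by simp
  moreover have "unimodal (\<lambda>x. \<integral>\<^sup>+y. f (y + x) * g y \<partial>lborel)" (is "unimodal ?D")
    by (rule unimodal_correlation[OF assms])
  moreover have "?D (- x) = ?D x" for x using calculation(2) by (rule unimodal_even)
  ultimately show ?thesis by simp
qed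

text \<open>
  The convolution power of \<open>p2\<close> with \<open>g + 1\<close> factors.
\<close>

definition p2_pow :: "nat \<Rightarrow> real \<Rightarrow> real" where
  "p2_pow g = (conv p2 ^^ g) p2"

lemma p2_pow_0 [simp]: "p2_pow 0 = p2" by (simp add: p2_pow_def)
lemma p2_pow_Suc: "p2_pow (Suc g) = conv p2 (p2_pow g)" by (simp add: p2_pow_def)
lemma kappa_eq: "kappa g = p2_pow (g - 1) 0" by (simp add: kappa_def p2_pow_def)

lemma conv_p2:
  assumes [measurable]: "f \<in> borel_measurable borel" and f: "\<And>x. 0 \<le> f x" "\<And>x. f x \<le> b"
  shows "conv p2 f \<in> borel_measurable borel" "0 \<le> conv p2 f x" "conv p2 f x \<le> 2 * b"
    "ennreal (conv p2 f x) = (\<integral>\<^sup>+y. ennreal (p2 (x - y)) * ennreal (f y) \<partial>lborel)"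
proof -
  show "conv p2 f \<in> borel_measurable borel" unfolding conv_def[abs_def] by measurable
  have b: "b \<ge> 0" using f[of 0] by simp
  have le: "(\<integral>\<^sup>+y. ennreal (p2 (x - y) * f y) \<partial>lborel) \<le> ennreal (2 * b)"
  proof -
    have "(\<integral>\<^sup>+y. ennreal (p2 (x - y) * f y) \<partial>lborel)
        \<le> (\<integral>\<^sup>+y. ennreal (2 * b) * indicator {x - 1 / 2..x + 1 / 2} y \<partial>lborel)"
    proof (intro nn_integral_mono)
      fix y
      have "p2 (x - y) * f y \<le> (2 * indicator {- 1 / 2..1 / 2} (x - y)) * b"
        using f p2_le p2_nonneg b by (intro mult_mono) auto
      hence "ennreal (p2 (x - y) * f y) \<le> ennreal ((2 * indicator {- 1 / 2..1 / 2} (x - y)) * b)"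
        by (rule ennreal_leI)
      also have "\<dots> = ennreal (2 * b) * indicator {x - 1 / 2..x + 1 / 2} y"
        by (auto simp: indicator_def)
      finally show "ennreal (p2 (x - y) * f y) \<le> ennreal (2 * b) * indicator {x - 1 / 2..x + 1 / 2} y" .
    qed
    also have "\<dots> = ennreal (2 * b)" by (subst nn_integral_cmult_indicator) auto
    finally show ?thesis .
  qed
  have "integrable lborel (\<lambda>y. p2 (x - y) * f y)"
    by (rule integrableI_nonneg) (auto simp: f p2_nonneg intro: le_less_trans[OF le])
  hence eq: "(\<integral>\<^sup>+y. ennreal (p2 (x - y) * f y) \<partial>lborel) = ennreal (conv p2 f x)"
    unfolding conv_def by (rule nn_integral_eq_integral) (auto simp: f p2_nonneg)
  show "0 \<le> conv p2 f x" unfolding conv_def by (simp add: f p2_nonneg)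
  show "conv p2 f x \<le> 2 * b" using le b by (simp add: eq)
  show "ennreal (conv p2 f x) = (\<integral>\<^sup>+y. ennreal (p2 (x - y)) * ennreal (f y) \<partial>lborel)"
    by (simp add: eq[symmetric] ennreal_mult f p2_nonneg)
qed

lemma p2_pow_bounds: "p2_pow g \<in> borel_measurable borel \<and> (\<forall>x. 0 \<le> p2_pow g x \<and> p2_pow g x \<le> 2 ^ Suc g)"
proof (induction g)
  case 0
  have "p2 x \<le> 2" for x by (simp add: p2_def)
  thus ?case by (simp add: p2_nonneg)
next
  case (Suc g)
  thus ?case using conv_p2[of "p2_pow g" "2 ^ Suc g"] by (auto simp: p2_pow_Suc)
qed

lemma ennreal_p2_pow_Suc:
  "ennreal (p2_pow (Suc g) x) = (\<integral>\<^sup>+y. ennreal (p2 (x - y)) * ennreal (p2_pow g y) \<partial>lborel)"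
  using conv_p2(4)[of "p2_pow g" "2 ^ Suc g"] p2_pow_bounds[of g] by (simp add: p2_pow_Suc)

lemma unimodal_p2_pow: "unimodal (\<lambda>x. ennreal (p2_pow g x))"
proof (induction g)
  case (Suc g)
  thus ?case unfolding ennreal_p2_pow_Suc by (intro unimodal_convolution unimodal_p2)
qed (simp add: unimodal_p2)

lemma kappa_nonneg: "0 \<le> kappa g"
  using p2_pow_bounds by (simp add: kappa_eq)

text \<open>
  The law of \<open>X\<close> on the event \<open>G\<close>; its total mass is the probability of \<open>G\<close>.
\<close>

definition restricted_law :: "'a measure \<Rightarrow> 'a set \<Rightarrow> ('a \<Rightarrow> real) \<Rightarrow> real measure" where
  "restricted_law M G X = distr (density M (indicator G)) borel X"

lemma sets_restricted_law [simp, measurable_cong]: "sets (restricted_law M G X) = sets borel"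
  by (simp add: restricted_law_def)

lemma emeasure_restricted_law:
  assumes [measurable]: "G \<in> sets M" "X \<in> borel_measurable M" "S \<in> sets borel"
  shows "emeasure (restricted_law M G X) S = emeasure M {x\<in>space M. x \<in> G \<and> X x \<in> S}"
proof -
  have "emeasure (restricted_law M G X) S = emeasure (density M (indicator G)) {x\<in>space M. X x \<in> S}"
    unfolding restricted_law_def by (subst emeasure_distr) (auto intro!: arg_cong[of _ _ "emeasure _"])
  also have "\<dots> = (\<integral>\<^sup>+x. indicator G x * indicator {x\<in>space M. X x \<in> S} x \<partial>M)"
    by (rule emeasure_density) measurable
  also have "\<dots> = (\<integral>\<^sup>+x. indicator {x\<in>space M. x \<in> G \<and> X x \<in> S} x \<partial>M)"
    by (intro nn_integral_cong) (auto simp: indicator_def)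
  also have "\<dots> = emeasure M {x\<in>space M. x \<in> G \<and> X x \<in> S}"
    by (rule nn_integral_indicator) measurable
  finally show ?thesis .
qed

lemma nn_integral_restricted_law:
  assumes [measurable]: "G \<in> sets M" "X \<in> borel_measurable M" "f \<in> borel_measurable borel"
  shows "(\<integral>\<^sup>+y. f y \<partial>restricted_law M G X) = (\<integral>\<^sup>+x. indicator G x * f (X x) \<partial>M)"
  unfolding restricted_law_def by (simp add: nn_integral_distr nn_integral_density)

lemma finite_measure_restricted_law:
  assumes "finite_measure M" and [measurable]: "G \<in> sets M" "X \<in> borel_measurable M"
  shows "finite_measure (restricted_law M G X)"
proof -
  interpret finite_measure M by fact
  show ?thesis
    by (rule finite_measureI) (simp add: emeasure_restricted_law restricted_law_def[THEN arg_cong, of space] emeasure_eq_measure)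
qed

context prob_space
begin

abbreviation power_space :: "'i set \<Rightarrow> ('i \<Rightarrow> 'a) measure" where
  "power_space I \<equiv> \<Pi>\<^sub>M i\<in>I. M"

lemma finite_measure_power_space: "finite_measure (power_space I)"
proof -
  interpret P: product_prob_space "\<lambda>_. M" I ..
  show ?thesis by (rule P.P.finite_measure_axioms)
qed

lemma majorized_iid_sum:
  fixes X :: "'a \<Rightarrow> real" and I :: "'i set"
  assumes [measurable]: "G \<in> events" "X \<in> borel_measurable M"
    and maj: "majorized (restricted_law M G X) (\<lambda>x. ennreal (p2 x))"
    and "finite I" "I \<noteq> {}"
  shows "majorized (restricted_law (power_space I) {w\<in>space (power_space I). \<forall>i\<in>I. w i \<in> G} (\<lambda>w. \<Sum>i\<in>I. X (w i)))
     (\<lambda>x. ennreal (p2_pow (card I - 1) x))"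
  using assms(4,5)
proof (induction rule: finite_ne_induct)
  case (singleton j)
  interpret P: product_sigma_finite "\<lambda>_::'i. M" ..
  have "emeasure (restricted_law (power_space {j}) {w\<in>space (power_space {j}). \<forall>i\<in>{j}. w i \<in> G} (\<lambda>w. \<Sum>i\<in>{j}. X (w i))) S
     = emeasure (restricted_law M G X) S" if [measurable]: "S \<in> sets borel" for S
  proof -
    let ?A = "{w\<in>space (power_space {j}). (w::'i \<Rightarrow> 'a) j \<in> G \<and> X (w j) \<in> S}"
    have "emeasure (restricted_law (power_space {j}) {w\<in>space (power_space {j}). \<forall>i\<in>{j}. w i \<in> G} (\<lambda>w. \<Sum>i\<in>{j}. X (w i))) S
        = emeasure (power_space {j}) ?A"
      by (subst emeasure_restricted_law) (auto intro!: arg_cong[of _ _ "emeasure _"])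
    also have "\<dots> = (\<integral>\<^sup>+w. indicator {x\<in>space M. x \<in> G \<and> X x \<in> S} (w j) \<partial>power_space {j})"
    proof -
      have "emeasure (power_space {j}) ?A = (\<integral>\<^sup>+w. indicator ?A w \<partial>power_space {j})"
        by (rule nn_integral_indicator[symmetric]) measurable
      also have "\<dots> = (\<integral>\<^sup>+w. indicator {x\<in>space M. x \<in> G \<and> X x \<in> S} (w j) \<partial>power_space {j})"
        by (intro nn_integral_cong) (auto simp: indicator_def space_PiM)
      finally show ?thesis .
    qed
    also have "\<dots> = (\<integral>\<^sup>+x. indicator {x\<in>space M. x \<in> G \<and> X x \<in> S} x \<partial>M)"
      by (rule P.product_nn_integral_singleton) measurable
    finally show ?thesis by (simp add: emeasure_restricted_law)
  qed
  thus ?case using maj by (simp add: majorized_def)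
next
  case (insert j I)
  interpret P: product_sigma_finite "\<lambda>_::'i. M" ..
  let ?\<nu> = "restricted_law M G X"
  let ?A = "\<lambda>I. {w\<in>space (power_space I). \<forall>i\<in>I. w i \<in> G}"
  let ?\<tau> = "\<lambda>I. restricted_law (power_space I) (?A I) (\<lambda>w. \<Sum>i\<in>I. X (w i))"
  have [measurable]: "?A I \<in> sets (power_space I)" using insert.hyps by measurable
  have "finite (insert j I)" using insert.hyps by simp
  hence [measurable]: "?A (insert j I) \<in> sets (power_space (insert j I))" by measurable
  have fin: "finite_measure ?\<nu>" "finite_measure (?\<tau> I)"
    by (rule finite_measure_restricted_law; (rule finite_measure_power_space finite_measure_axioms | measurable | simp add: insert.hyps))+
  have eq: "emeasure (?\<tau> (insert j I)) S = emeasure (?\<nu> \<star> ?\<tau> I) S" if S[measurable]: "S \<in> sets borel" for S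
  proof -
    have "emeasure (?\<tau> (insert j I)) S
        = emeasure (power_space (insert j I)) {w\<in>space (power_space (insert j I)). (\<forall>i\<in>insert j I. w i \<in> G) \<and> (\<Sum>i\<in>insert j I. X (w i)) \<in> S}" (is "_ = emeasure _ ?B")
      using insert.hyps by (subst emeasure_restricted_law) (auto intro!: arg_cong[of _ _ "emeasure _"])
    also have "\<dots> = (\<integral>\<^sup>+w. indicator ?B w \<partial>power_space (insert j I))"
      using insert.hyps by (intro nn_integral_indicator[symmetric]) measurable
    also have "\<dots> = (\<integral>\<^sup>+y. (\<integral>\<^sup>+w. indicator ?B (w(j := y)) \<partial>power_space I) \<partial>M)"
      using insert.hyps by (intro P.product_nn_integral_insert_rev) measurable
    also have "\<dots> = (\<integral>\<^sup>+y. indicator G y * emeasure (?\<tau> I) {z. X y + z \<in> S} \<partial>M)"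
    proof (intro nn_integral_cong)
      fix y assume y: "y \<in> space M"
      have "(\<integral>\<^sup>+w. indicator ?B (w(j := y)) \<partial>power_space I)
          = (\<integral>\<^sup>+w. indicator G y * indicator {w\<in>space (power_space I). w \<in> ?A I \<and> (\<Sum>i\<in>I. X (w i)) \<in> {z. X y + z \<in> S}} w \<partial>power_space I)"
      proof (intro nn_integral_cong)
        fix w assume w: "w \<in> space (power_space I)"
        have "w(j := y) \<in> space (power_space (insert j I))"
          using w y by (auto simp: space_PiM PiE_def extensional_def)
        moreover have "(\<Sum>i\<in>I. X ((w(j := y)) i)) = (\<Sum>i\<in>I. X (w i))"
          using insert.hyps by (intro sum.cong) auto
        moreover have "(\<forall>i\<in>I. (w(j := y)) i \<in> G) = (\<forall>i\<in>I. w i \<in> G)"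
          using insert.hyps by auto
        ultimately show "indicator ?B (w(j := y)) = (indicator G y * indicator {w\<in>space (power_space I). w \<in> ?A I \<and> (\<Sum>i\<in>I. X (w i)) \<in> {z. X y + z \<in> S}} w :: ennreal)"
          using w insert.hyps by (simp add: indicator_def)
      qed
      also have "\<dots> = indicator G y * emeasure (?\<tau> I) {z. X y + z \<in> S}"
        using insert.hyps by (subst nn_integral_cmult) (auto simp: emeasure_restricted_law)
      finally show "(\<integral>\<^sup>+w. indicator ?B (w(j := y)) \<partial>power_space I) = indicator G y * emeasure (?\<tau> I) {z. X y + z \<in> S}" .
    qed
    also have "\<dots> = (\<integral>\<^sup>+u. emeasure (?\<tau> I) {z. u + z \<in> S} \<partial>?\<nu>)"
    proof (rule nn_integral_restricted_law[symmetric])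
      interpret \<tau>: finite_measure "?\<tau> I" by (rule fin)
      have "(\<lambda>u. \<integral>\<^sup>+z. indicator S (u + z) \<partial>?\<tau> I) \<in> borel_measurable borel" by measurable
      also have "(\<lambda>u. \<integral>\<^sup>+z. indicator S (u + z) \<partial>?\<tau> I) = (\<lambda>u. \<integral>\<^sup>+z. indicator {z. u + z \<in> S} z \<partial>?\<tau> I)"
        by (intro ext nn_integral_cong) (simp add: indicator_def)
      also have "\<dots> = (\<lambda>u. emeasure (?\<tau> I) {z. u + z \<in> S})"
        by (intro ext nn_integral_indicator) measurable
      finally show "(\<lambda>u. emeasure (?\<tau> I) {z. u + z \<in> S}) \<in> borel_measurable borel" .
    qed measurable
    also have "\<dots> = emeasure (?\<nu> \<star> ?\<tau> I) S"
      using fin by (subst convolution_emeasure) (auto simp: add.commute restricted_law_def)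
    finally show ?thesis .
  qed
  have "majorized (?\<nu> \<star> ?\<tau> I) (\<lambda>z. \<integral>\<^sup>+y. ennreal (p2 (z - y)) * ennreal (p2_pow (card I - 1) y) \<partial>lborel)"
  proof (rule majorized_convolution[OF maj fin(1) _ insert.IH fin(2) _ unimodal_p2 _ unimodal_p2_pow])
    show "ennreal (p2 x) \<le> ennreal (2 ^ Suc 0)" for x using p2_pow_bounds[of 0] by (intro ennreal_leI) simp
    show "ennreal (p2_pow (card I - 1) x) \<le> ennreal (2 ^ Suc (card I - 1))" for x
      using p2_pow_bounds[of "card I - 1"] by (intro ennreal_leI) simp
  qed auto
  moreover have "card (insert j I) - 1 = Suc (card I - 1)"
    using insert.hyps by (simp add: card_gt_0_iff)
  ultimately show ?case using eq by (simp add: majorized_def ennreal_p2_pow_Suc)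
qed

lemma iid_sum_density_bound:
  fixes X :: "'a \<Rightarrow> real" and I :: "'i set"
  assumes [measurable]: "G \<in> events" "X \<in> borel_measurable M" "S \<in> sets borel"
    and maj: "majorized (restricted_law M G X) (\<lambda>x. ennreal (p2 x))"
    and "finite I" "I \<noteq> {}"
  shows "emeasure (power_space I) {w\<in>space (power_space I). (\<forall>i\<in>I. w i \<in> G) \<and> (\<Sum>i\<in>I. X (w i)) \<in> S}
    \<le> ennreal (kappa (card I)) * emeasure lborel S"
proof -
  let ?A = "{w\<in>space (power_space I). \<forall>i\<in>I. w i \<in> G}"
  have [measurable]: "?A \<in> sets (power_space I)" using \<open>finite I\<close> by measurable
  have "emeasure (restricted_law (power_space I) ?A (\<lambda>w. \<Sum>i\<in>I. X (w i))) S
      \<le> ennreal (kappa (card I)) * emeasure lborel S"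
    by (rule majorized_density_bound[OF majorized_iid_sum[OF assms(1,2) maj assms(5,6)] unimodal_p2_pow])
       (auto simp: kappa_eq p2_pow_bounds)
  thus ?thesis
    by (simp add: emeasure_restricted_law conj_assoc cong: conj_cong)
qed

text \<open>
  The coordinates in \<open>J\<close> are integrated last: once they are fixed, their sum only translates \<open>S\<close>.
\<close>

lemma pattern_density_bound:
  fixes X :: "'a \<Rightarrow> real" and I J :: "'i set"
  assumes [measurable]: "G \<in> events" "X \<in> borel_measurable M" "S \<in> sets borel"
    and maj: "majorized (restricted_law M G X) (\<lambda>x. ennreal (p2 x))"
    and IJ: "finite I" "I \<noteq> {}" "finite J" "J \<inter> I = {}"
  shows "emeasure (power_space (J \<union> I)) {w\<in>space (power_space (J \<union> I)).
      (\<forall>i\<in>I. w i \<in> G) \<and> (\<forall>j\<in>J. w j \<notin> G) \<and> (\<Sum>i\<in>J \<union> I. X (w i)) \<in> S}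
    \<le> ennreal (kappa (card I)) * emeasure lborel S * emeasure M (space M - G) ^ card J"
proof -
  interpret P: product_sigma_finite "\<lambda>_::'i. M" ..
  let ?B = "{w\<in>space (power_space (J \<union> I)).
      (\<forall>i\<in>I. w i \<in> G) \<and> (\<forall>j\<in>J. w j \<notin> G) \<and> (\<Sum>i\<in>J \<union> I. X (w i)) \<in> S}"
  have [measurable]: "?B \<in> sets (power_space (J \<union> I))" using IJ by measurable
  have "emeasure (power_space (J \<union> I)) ?B = (\<integral>\<^sup>+w. indicator ?B w \<partial>power_space (J \<union> I))"
    by simp
  also have "\<dots> = (\<integral>\<^sup>+x. (\<integral>\<^sup>+y. indicator ?B (merge J I (x, y)) \<partial>power_space I) \<partial>power_space J)"
    using IJ by (intro P.product_nn_integral_fold) auto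
  also have "\<dots> \<le> (\<integral>\<^sup>+x. (\<Prod>j\<in>J. indicator (space M - G) (x j)) * (ennreal (kappa (card I)) * emeasure lborel S) \<partial>power_space J)"
  proof (intro nn_integral_mono)
    fix x assume x: "x \<in> space (power_space J)"
    show "(\<integral>\<^sup>+y. indicator ?B (merge J I (x, y)) \<partial>power_space I)
        \<le> (\<Prod>j\<in>J. indicator (space M - G) (x j)) * (ennreal (kappa (card I)) * emeasure lborel S)"
    proof (cases "\<forall>j\<in>J. x j \<notin> G")
      case True
      let ?S = "{z. (\<Sum>j\<in>J. X (x j)) + z \<in> S}"
      have "(\<integral>\<^sup>+y. indicator ?B (merge J I (x, y)) \<partial>power_space I)
          \<le> (\<integral>\<^sup>+y. indicator {w\<in>space (power_space I). (\<forall>i\<in>I. w i \<in> G) \<and> (\<Sum>i\<in>I. X (w i)) \<in> ?S} y \<partial>power_space I)"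
      proof (intro nn_integral_mono)
        fix y assume y: "y \<in> space (power_space I)"
        have m: "merge J I (x, y) j = x j" if "j \<in> J" for j using that by (simp add: merge_def)
        have m': "merge J I (x, y) i = y i" if "i \<in> I" for i using that IJ by (auto simp: merge_def)
        have "(\<Sum>i\<in>J \<union> I. X (merge J I (x, y) i)) = (\<Sum>j\<in>J. X (x j)) + (\<Sum>i\<in>I. X (y i))"
          using IJ m m' by (simp add: sum.union_disjoint)
        thus "indicator ?B (merge J I (x, y)) \<le> (indicator {w\<in>space (power_space I). (\<forall>i\<in>I. w i \<in> G) \<and> (\<Sum>i\<in>I. X (w i)) \<in> ?S} y :: ennreal)"
          using y m' by (auto simp: indicator_def)
      qed
      also have "\<dots> = emeasure (power_space I) {w\<in>space (power_space I). (\<forall>i\<in>I. w i \<in> G) \<and> (\<Sum>i\<in>I. X (w i)) \<in> ?S}"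
        using IJ by (intro nn_integral_indicator) measurable
      also have "\<dots> \<le> ennreal (kappa (card I)) * emeasure lborel ?S"
        by (rule iid_sum_density_bound) (use maj IJ in measurable)
      also have "emeasure lborel ?S = emeasure lborel S" by (rule emeasure_lborel_shift) fact
      finally show ?thesis
        using True x by (simp add: space_PiM PiE_iff)
    next
      case False
      then obtain j where j: "j \<in> J" "x j \<in> G" by auto
      have "indicator ?B (merge J I (x, y)) = (0 :: ennreal)" for y
        using j by (auto simp: indicator_def merge_def)
      thus ?thesis by simp
    qed
  qed
  also have "\<dots> = (\<integral>\<^sup>+x. (\<Prod>j\<in>J. indicator (space M - G) (x j)) \<partial>power_space J) * (ennreal (kappa (card I)) * emeasure lborel S)"
    using IJ by (intro nn_integral_multc borel_measurable_prod_ennreal) measurable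
  also have "(\<integral>\<^sup>+x. (\<Prod>j\<in>J. indicator (space M - G) (x j)) \<partial>power_space J) = emeasure M (space M - G) ^ card J"
    using IJ by (subst P.product_nn_integral_prod) auto
  finally show ?thesis by (simp add: mult.commute)
qed

text \<open>
  Split according to the set \<open>K\<close> of good coordinates; the sets of size \<open>g\<close> produce the binomial
  coefficient.
\<close>

lemma some_good_density_bound:
  fixes X :: "'a \<Rightarrow> real" and I :: "'i set"
  assumes [measurable]: "G \<in> events" "X \<in> borel_measurable M" "S \<in> sets borel"
    and maj: "majorized (restricted_law M G X) (\<lambda>x. ennreal (p2 x))"
    and "finite I" and q: "emeasure M (space M - G) \<le> ennreal q" "q \<ge> 0"
  shows "emeasure (power_space I) {w\<in>space (power_space I). (\<exists>i\<in>I. w i \<in> G) \<and> (\<Sum>i\<in>I. X (w i)) \<in> S}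
    \<le> ennreal (\<Sum>g = 1..card I. real (card I choose g) * kappa g * q ^ (card I - g)) * emeasure lborel S"
proof -
  define P where "P K = {w\<in>space (power_space I). (\<forall>i\<in>K. w i \<in> G) \<and> (\<forall>j\<in>I - K. w j \<notin> G) \<and> (\<Sum>i\<in>I. X (w i)) \<in> S}" for K
  define c where "c g = kappa g * q ^ (card I - g)" for g
  have c: "c g \<ge> 0" for g using q by (simp add: c_def kappa_nonneg)
  have [measurable]: "P K \<in> sets (power_space I)" if "K \<subseteq> I" for K
  proof -
    have K: "finite K" "finite (I - K)" using that \<open>finite I\<close> finite_subset by auto
    have "i \<in> I" if "i \<in> K" for i using that \<open>K \<subseteq> I\<close> by auto
    thus ?thesis unfolding P_def using K \<open>finite I\<close> by measurable
  qed
  have bound: "emeasure (power_space I) (P K) \<le> ennreal (c (card K)) * emeasure lborel S"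
    if K: "K \<subseteq> I" "K \<noteq> {}" for K
  proof -
    have I: "(I - K) \<union> K = I" using K by auto
    have "emeasure (power_space I) (P K)
        \<le> ennreal (kappa (card K)) * emeasure lborel S * emeasure M (space M - G) ^ card (I - K)"
      using pattern_density_bound[OF assms(1,2,3) maj, of K "I - K", unfolded I] K \<open>finite I\<close>
      unfolding P_def by (auto intro: finite_subset)
    also have "\<dots> \<le> ennreal (kappa (card K)) * emeasure lborel S * ennreal q ^ card (I - K)"
      using q by (intro mult_left_mono power_mono) auto
    also have "\<dots> = ennreal (c (card K)) * emeasure lborel S"
      using K q \<open>finite I\<close> by (simp add: c_def card_Diff_subset finite_subset ennreal_mult kappa_nonneg ennreal_power ac_simps)
    finally show ?thesis .
  qed
  let ?K = "{K. K \<subseteq> I \<and> K \<noteq> {}}"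
  have fK: "finite ?K" using \<open>finite I\<close> by simp
  have "{w\<in>space (power_space I). (\<exists>i\<in>I. w i \<in> G) \<and> (\<Sum>i\<in>I. X (w i)) \<in> S} \<subseteq> (\<Union>K\<in>?K. P K)"
  proof safe
    fix w i assume "w \<in> space (power_space I)" "i \<in> I" "w i \<in> G" "(\<Sum>i\<in>I. X (w i)) \<in> S"
    hence "w \<in> P {i\<in>I. w i \<in> G}" "{i\<in>I. w i \<in> G} \<in> ?K" by (auto simp: P_def)
    thus "w \<in> (\<Union>K\<in>?K. P K)" by blast
  qed
  hence "emeasure (power_space I) {w\<in>space (power_space I). (\<exists>i\<in>I. w i \<in> G) \<and> (\<Sum>i\<in>I. X (w i)) \<in> S}
      \<le> emeasure (power_space I) (\<Union>K\<in>?K. P K)"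
    using fK by (intro emeasure_mono sets.finite_UN) auto
  also have "\<dots> \<le> (\<Sum>K\<in>?K. emeasure (power_space I) (P K))"
    using fK by (intro emeasure_subadditive_finite) auto
  also have "\<dots> \<le> (\<Sum>K\<in>?K. ennreal (c (card K)) * emeasure lborel S)"
    by (intro sum_mono bound) auto
  also have "\<dots> = ennreal (\<Sum>K\<in>?K. c (card K)) * emeasure lborel S"
    using c by (simp add: sum_distrib_right[symmetric] sum_ennreal)
  also have "(\<Sum>K\<in>?K. c (card K)) = (\<Sum>g = 1..card I. \<Sum>K | K \<in> ?K \<and> card K = g. c (card K))"
  proof (rule sum.group[symmetric])
    show "card ` ?K \<subseteq> {1..card I}"
      using \<open>finite I\<close> by (auto simp: card_mono Suc_le_eq card_gt_0_iff finite_subset)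
  qed (use fK in auto)
  also have "\<dots> = (\<Sum>g = 1..card I. real (card I choose g) * kappa g * q ^ (card I - g))"
  proof (intro sum.cong refl)
    fix g assume "g \<in> {1..card I}"
    hence "{K. K \<in> ?K \<and> card K = g} = {K. K \<subseteq> I \<and> card K = g}" by auto
    thus "(\<Sum>K | K \<in> ?K \<and> card K = g. c (card K)) = real (card I choose g) * kappa g * q ^ (card I - g)"
      using n_subsets[OF \<open>finite I\<close>, of g] by (simp add: c_def)
  qed
  finally show ?thesis .
qed

lemma no_good_bound:
  fixes I :: "'i set"
  assumes [measurable]: "G \<in> events" and "finite I" and q: "emeasure M (space M - G) \<le> ennreal q" "q \<ge> 0"
  shows "emeasure (power_space I) {w\<in>space (power_space I). \<forall>i\<in>I. w i \<notin> G} \<le> ennreal (q ^ card I)"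
proof -
  interpret P: product_sigma_finite "\<lambda>_::'i. M" ..
  have "{w\<in>space (power_space I). \<forall>i\<in>I. w i \<notin> G} = (\<Pi>\<^sub>E i\<in>I. space M - G)"
    by (auto simp: space_PiM PiE_iff extensional_def)
  hence "emeasure (power_space I) {w\<in>space (power_space I). \<forall>i\<in>I. w i \<notin> G} = emeasure M (space M - G) ^ card I"
    using \<open>finite I\<close> by (simp add: P.emeasure_PiM)
  also have "\<dots> \<le> ennreal q ^ card I" using q by (intro power_mono) auto
  finally show ?thesis using q by (simp add: ennreal_power)
qed

end

section \<open>The recursion for effective couplings\<close>

text \<open>
  This is \<open>artanh (tanh a * tanh b)\<close>. In the present form it is the logarithm of a ratio of
  two-edge partition functions, and its derivative in \<open>a\<close> is a difference of hyperbolic tangents.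
\<close>

definition star :: "real \<Rightarrow> real \<Rightarrow> real" where
  "star a b = ln (cosh (a + b) / cosh (a - b)) / 2"

abbreviation halves :: "nat \<Rightarrow> half set" where
  "halves n \<equiv> {..<n} \<times> UNIV"

definition block :: "nat \<Rightarrow> nat \<Rightarrow> half \<Rightarrow> (edge \<Rightarrow> real) \<Rightarrow> edge \<Rightarrow> real" where
  "block n N c J = (\<lambda>e\<in>edges n N. J (c # e))"

lemma finite_verts: "finite (verts n N)"
proof -
  have "{Mid xs i | xs i. set xs \<subseteq> halves n \<and> length xs < N \<and> i < n}
      \<subseteq> (\<lambda>(xs, i). Mid xs i) ` ({xs. set xs \<subseteq> halves n \<and> length xs \<le> N} \<times> {..<n})" by auto
  moreover have "finite ({xs. set xs \<subseteq> halves n \<and> length xs \<le> N} \<times> {..<n})"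
    by (intro finite_cartesian_product finite_lists_length_le) auto
  ultimately have "finite {Mid xs i | xs i. set xs \<subseteq> halves n \<and> length xs < N \<and> i < n}"
    by (meson finite_imageI finite_subset)
  thus ?thesis by (simp add: verts_def)
qed

lemma edges_Suc: "edges n (Suc N) = (\<lambda>(c, e). c # e) ` (halves n \<times> edges n N)"
proof safe
  fix x assume "x \<in> edges n (Suc N)"
  thus "x \<in> (\<lambda>(c, e). c # e) ` (halves n \<times> edges n N)"
    by (cases x) (auto simp: edges_def image_iff)
qed (auto simp: edges_def)

lemma sum_edges_Suc:
  "(\<Sum>e\<in>edges n (Suc N). f e) = (\<Sum>c\<in>halves n. \<Sum>e\<in>edges n N. f (c # e))"
proof -
  have "inj_on (\<lambda>(c, e). c # e) (halves n \<times> edges n N)" by (auto simp: inj_on_def)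
  hence "(\<Sum>e\<in>edges n (Suc N). f e) = (\<Sum>(c, e)\<in>halves n \<times> edges n N. f (c # e))"
    unfolding edges_Suc by (subst sum.reindex) (auto intro!: sum.cong)
  thus ?thesis unfolding sum.cartesian_product .
qed

lemma verts_Suc:
  "v \<in> verts n (Suc N) \<longleftrightarrow> v = Pole1 \<or> v = Pole2 \<or> (\<exists>i<n. v = Mid [] i)
     \<or> (\<exists>c\<in>halves n. \<exists>xs i. v = Mid (c # xs) i \<and> Mid xs i \<in> verts n N)"
proof
  assume "v \<in> verts n (Suc N)"
  then consider "v = Pole1" | "v = Pole2" | xs i where "v = Mid xs i" "set xs \<subseteq> halves n" "length xs < Suc N" "i < n"
    by (auto simp: verts_def)
  thus "v = Pole1 \<or> v = Pole2 \<or> (\<exists>i<n. v = Mid [] i)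
     \<or> (\<exists>c\<in>halves n. \<exists>xs i. v = Mid (c # xs) i \<and> Mid xs i \<in> verts n N)"
  proof cases
    case 3
    thus ?thesis by (cases xs) (auto simp: verts_def)
  qed auto
qed (auto simp: verts_def)

lemma poles_in_verts: "Pole1 \<in> verts n N" "Pole2 \<in> verts n N" by (auto simp: verts_def)

lemma embed_in_verts: "c \<in> halves n \<Longrightarrow> v \<in> verts n N \<Longrightarrow> embed c v \<in> verts n (Suc N)"
  by (cases v; cases c; cases "snd c") (auto simp: verts_def)

lemma endpoints_in_verts:
  "e \<in> edges n N \<Longrightarrow> fst (endpoints e) \<in> verts n N \<and> snd (endpoints e) \<in> verts n N"
proof (induction N arbitrary: e)
  case 0
  thus ?case by (auto simp: edges_def verts_def)
next
  case (Suc N)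
  then obtain c e' where e: "e = c # e'" "c \<in> halves n" "e' \<in> edges n N" by (auto simp: edges_Suc)
  thus ?case using Suc.IH[OF e(3)] by (simp add: embed_in_verts)
qed

text \<open>
  The two functions \<open>left_end\<close> and \<open>right_end\<close> give the pole spins of the half \<open>c\<close> when the outer
  pole on that side carries \<open>s\<close> and the midpoints carry \<open>m\<close>.
\<close>

definition left_end :: "real \<Rightarrow> (nat \<Rightarrow> real) \<Rightarrow> half \<Rightarrow> real" where
  "left_end s m c = (if snd c then m (fst c) else s)"

definition right_end :: "real \<Rightarrow> (nat \<Rightarrow> real) \<Rightarrow> half \<Rightarrow> real" where
  "right_end s m c = (if snd c then s else m (fst c))"

text \<open>
  A configuration is the same as a spin for every midpoint together with configurations of all
  halves whose pole spins agree with the midpoints and the outer poles.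
\<close>

definition glue :: "nat \<Rightarrow> nat \<Rightarrow> real \<Rightarrow> real \<Rightarrow> (nat \<Rightarrow> real) \<times> (half \<Rightarrow> vertex \<Rightarrow> real) \<Rightarrow> vertex \<Rightarrow> real" where
  "glue n N s s' p = (\<lambda>v\<in>verts n (Suc N). case v of Pole1 \<Rightarrow> s | Pole2 \<Rightarrow> s'
     | Mid xs i \<Rightarrow> (case xs of [] \<Rightarrow> fst p i | c # ys \<Rightarrow> snd p c (Mid ys i)))"

definition unglue :: "nat \<Rightarrow> nat \<Rightarrow> (vertex \<Rightarrow> real) \<Rightarrow> (nat \<Rightarrow> real) \<times> (half \<Rightarrow> vertex \<Rightarrow> real)" where
  "unglue n N \<sigma> = ((\<lambda>i\<in>{..<n}. \<sigma> (Mid [] i)), (\<lambda>c\<in>halves n. \<lambda>v\<in>verts n N. \<sigma> (embed c v)))"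

abbreviation glued_configs :: "nat \<Rightarrow> nat \<Rightarrow> real \<Rightarrow> real \<Rightarrow> ((nat \<Rightarrow> real) \<times> (half \<Rightarrow> vertex \<Rightarrow> real)) set" where
  "glued_configs n N s s' \<equiv> (SIGMA m : {..<n} \<rightarrow>\<^sub>E {-1, 1}.
     \<Pi>\<^sub>E c\<in>halves n. configs n N (left_end s m c) (right_end s' m c))"

lemma glue_embed:
  assumes p: "(m, \<tau>) \<in> glued_configs n N s s'" and c: "c \<in> halves n" and v: "v \<in> verts n N"
  shows "glue n N s s' (m, \<tau>) (embed c v) = \<tau> c v"
proof -
  have \<tau>: "\<tau> c \<in> configs n N (left_end s m c) (right_end s' m c)" using p c by (auto dest: PiE_mem)
  have "embed c v \<in> verts n (Suc N)" using c v by (rule embed_in_verts)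
  thus ?thesis using \<tau>
    by (cases v; cases c; cases "snd c") (auto simp: glue_def configs_def left_end_def right_end_def)
qed

lemma glue_in_configs:
  assumes s: "s \<in> {-1, 1}" "s' \<in> {-1, 1}" and p: "(m, \<tau>) \<in> glued_configs n N s s'"
  shows "glue n N s s' (m, \<tau>) \<in> configs n (Suc N) s s'"
proof -
  have "glue n N s s' (m, \<tau>) v \<in> {-1, 1}" if v: "v \<in> verts n (Suc N)" for v
  proof -
    consider "v = Pole1" | "v = Pole2" | i where "i < n" "v = Mid [] i"
      | c xs i where "c \<in> halves n" "v = Mid (c # xs) i" "Mid xs i \<in> verts n N"
      using v by (auto simp: verts_Suc)
    thus ?thesis
    proof cases
      case 3
      have "m i \<in> {-1, 1}" using p 3 by (auto dest: PiE_mem)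
      thus ?thesis using 3 v by (simp add: glue_def)
    next
      case (4 c xs i)
      have "\<tau> c \<in> configs n N (left_end s m c) (right_end s' m c)" using p 4 by (auto dest: PiE_mem)
      hence "\<tau> c (Mid xs i) \<in> {-1, 1}" using 4 by (auto simp: configs_def dest: PiE_mem)
      thus ?thesis using 4 v by (simp add: glue_def)
    qed (use s v in \<open>auto simp: glue_def\<close>)
  qed
  moreover have "glue n N s s' (m, \<tau>) Pole1 = s" "glue n N s s' (m, \<tau>) Pole2 = s'"
    using poles_in_verts by (auto simp: glue_def)
  moreover have "glue n N s s' (m, \<tau>) v = undefined" if "v \<notin> verts n (Suc N)" for v
    using that by (simp add: glue_def)
  ultimately show ?thesis by (auto simp: configs_def PiE_iff extensional_def)
qed

lemma unglue_in_glued_configs: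
  assumes "\<sigma> \<in> configs n (Suc N) s s'"
  shows "unglue n N \<sigma> \<in> glued_configs n N s s'"
proof -
  have \<sigma>: "\<sigma> v \<in> {-1, 1}" if "v \<in> verts n (Suc N)" for v
    using assms that by (auto simp: configs_def dest: PiE_mem)
  have pole: "\<sigma> Pole1 = s" "\<sigma> Pole2 = s'" using assms by (auto simp: configs_def)
  define m where "m = (\<lambda>i\<in>{..<n}. \<sigma> (Mid [] i))"
  have "m \<in> {..<n} \<rightarrow>\<^sub>E {-1, 1}"
    unfolding m_def using \<sigma> by (intro restrict_PiE_iff[THEN iffD2]) (auto simp: verts_Suc)
  moreover have "(\<lambda>v\<in>verts n N. \<sigma> (embed c v)) \<in> configs n N (left_end s m c) (right_end s' m c)"
    if c: "c \<in> halves n" for c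
  proof -
    obtain i h where ih: "c = (i, h)" "i < n" using c by auto
    have "(\<lambda>v\<in>verts n N. \<sigma> (embed c v)) \<in> verts n N \<rightarrow>\<^sub>E {-1, 1}"
      using \<sigma>[OF embed_in_verts[OF c]] by (intro restrict_PiE_iff[THEN iffD2]) auto
    thus ?thesis using ih pole poles_in_verts
      by (cases h) (auto simp: configs_def left_end_def right_end_def m_def)
  qed
  ultimately show ?thesis by (auto simp: unglue_def m_def)
qed

lemma glue_unglue:
  assumes "\<sigma> \<in> configs n (Suc N) s s'"
  shows "glue n N s s' (unglue n N \<sigma>) = \<sigma>"
proof
  fix v
  have ext: "\<sigma> v = undefined" if "v \<notin> verts n (Suc N)" using assms that by (auto simp: configs_def)
  have pole: "\<sigma> Pole1 = s" "\<sigma> Pole2 = s'" using assms by (auto simp: configs_def)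
  show "glue n N s s' (unglue n N \<sigma>) v = \<sigma> v"
  proof (cases "v \<in> verts n (Suc N)")
    case v: True
    then consider "v = Pole1" | "v = Pole2" | i where "i < n" "v = Mid [] i"
      | c xs i where "c \<in> halves n" "v = Mid (c # xs) i" "Mid xs i \<in> verts n N"
      by (auto simp: verts_Suc)
    thus ?thesis
      by cases (use v pole in \<open>auto simp: glue_def unglue_def\<close>)
  qed (simp add: ext glue_def)
qed

lemma unglue_glue:
  assumes "p \<in> glued_configs n N s s'"
  shows "unglue n N (glue n N s s' p) = p"
proof -
  obtain m \<tau> where p: "p = (m, \<tau>)" by (cases p)
  have m: "m \<in> {..<n} \<rightarrow>\<^sub>E {-1, 1}" using assms p by auto
  have "(\<lambda>i\<in>{..<n}. glue n N s s' p (Mid [] i)) = m"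
    using m by (intro extensionalityI[of _ "{..<n}"]) (auto simp: glue_def verts_Suc p PiE_iff)
  moreover have "(\<lambda>c\<in>halves n. \<lambda>v\<in>verts n N. glue n N s s' p (embed c v)) = \<tau>"
  proof (rule extensionalityI[of _ "halves n"])
    show "\<tau> \<in> extensional (halves n)" using assms p by (auto simp: PiE_iff)
    fix c assume c: "c \<in> halves n"
    have "\<tau> c \<in> extensional (verts n N)" using assms p c by (auto simp: PiE_iff configs_def)
    hence "(\<lambda>v\<in>verts n N. glue n N s s' p (embed c v)) = \<tau> c"
      using glue_embed assms p c by (intro extensionalityI[of _ "verts n N"]) auto
    thus "(\<lambda>c\<in>halves n. \<lambda>v\<in>verts n N. glue n N s s' p (embed c v)) c = \<tau> c" using c by simp
  qed auto
  ultimately show ?thesis by (simp add: unglue_def p)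
qed

lemma finite_configs: "finite (configs n N s s')"
proof -
  have "finite (verts n N \<rightarrow>\<^sub>E {-1, 1 :: real})" by (intro finite_PiE finite_verts) auto
  thus ?thesis unfolding configs_def by (rule rev_finite_subset) auto
qed

lemma energy_glue:
  assumes p: "(m, \<tau>) \<in> glued_configs n N s s'"
  shows "exp (\<beta> * (\<Sum>e\<in>edges n (Suc N). J e * glue n N s s' (m, \<tau>) (fst (endpoints e)) * glue n N s s' (m, \<tau>) (snd (endpoints e))))
    = (\<Prod>c\<in>halves n. exp (\<beta> * (\<Sum>e\<in>edges n N. block n N c J e * \<tau> c (fst (endpoints e)) * \<tau> c (snd (endpoints e)))))"
proof -
  have "(\<Sum>e\<in>edges n (Suc N). J e * glue n N s s' (m, \<tau>) (fst (endpoints e)) * glue n N s s' (m, \<tau>) (snd (endpoints e)))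
     = (\<Sum>c\<in>halves n. \<Sum>e\<in>edges n N. block n N c J e * \<tau> c (fst (endpoints e)) * \<tau> c (snd (endpoints e)))"
    unfolding sum_edges_Suc
  proof (intro sum.cong refl)
    fix c e assume "c \<in> halves n" "e \<in> edges n N"
    thus "J (c # e) * glue n N s s' (m, \<tau>) (fst (endpoints (c # e))) * glue n N s s' (m, \<tau>) (snd (endpoints (c # e)))
        = block n N c J e * \<tau> c (fst (endpoints e)) * \<tau> c (snd (endpoints e))"
      using glue_embed[OF p] endpoints_in_verts[of e n N] by (simp add: block_def)
  qed
  thus ?thesis by (simp only: sum_distrib_left[of \<beta> _ "halves n"] exp_sum[OF finite_cartesian_product[OF finite_lessThan finite]])
qed

lemma prod_halves: "(\<Prod>c\<in>halves n. f c) = (\<Prod>i<n. f (i, False) * f (i, True))" for f :: "half \<Rightarrow> real"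
proof -
  have "(\<Prod>c\<in>halves n. f c) = (\<Prod>i<n. \<Prod>h\<in>UNIV. f (i, h))"
    unfolding prod.cartesian_product by (intro prod.cong) auto
  thus ?thesis by (simp add: UNIV_bool)
qed

text \<open>
  Given the spins of the midpoints the energy is a sum over the halves, which share no further
  vertex, so the sum over configurations factorizes.
\<close>

lemma partition_function_Suc:
  assumes "s \<in> {-1, 1}" "s' \<in> {-1, 1}"
  shows "partition_function n \<beta> (Suc N) J s s'
    = (\<Prod>i<n. \<Sum>m\<in>{-1, 1}. partition_function n \<beta> N (block n N (i, False) J) s m
        * partition_function n \<beta> N (block n N (i, True) J) m s')"
proof -
  define W where "W c \<tau> = exp (\<beta> * (\<Sum>e\<in>edges n N. block n N c J e * \<tau> (fst (endpoints e)) * \<tau> (snd (endpoints e))))" for c and \<tau> :: "vertex \<Rightarrow> real"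
  define Z where "Z c = partition_function n \<beta> N (block n N c J)" for c
  have Z: "(\<Sum>\<tau>\<in>configs n N l r. W c \<tau>) = Z c l r" for c l r
    by (simp add: Z_def W_def partition_function_def)
  have "partition_function n \<beta> (Suc N) J s s' = (\<Sum>p\<in>glued_configs n N s s'. \<Prod>c\<in>halves n. W c (snd p c))"
    unfolding partition_function_def
  proof (rule sum.reindex_bij_witness[of _ "glue n N s s'" "unglue n N"])
    fix \<sigma> assume \<sigma>: "\<sigma> \<in> configs n (Suc N) s s'"
    show "glue n N s s' (unglue n N \<sigma>) = \<sigma>" by (rule glue_unglue[OF \<sigma>])
    show "unglue n N \<sigma> \<in> glued_configs n N s s'" by (rule unglue_in_glued_configs[OF \<sigma>])
    obtain m \<tau> where p: "unglue n N \<sigma> = (m, \<tau>)" by (cases "unglue n N \<sigma>")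
    show "(\<Prod>c\<in>halves n. W c (snd (unglue n N \<sigma>) c)) = exp (\<beta> * (\<Sum>e\<in>edges n (Suc N). J e * \<sigma> (fst (endpoints e)) * \<sigma> (snd (endpoints e))))"
      using energy_glue[of m \<tau> n N s s' \<beta> J, folded p, OF unglue_in_glued_configs[OF \<sigma>]]
      unfolding glue_unglue[OF \<sigma>, unfolded p] p snd_conv W_def by (rule sym)
  next
    fix p assume p: "p \<in> glued_configs n N s s'"
    show "unglue n N (glue n N s s' p) = p" by (rule unglue_glue[OF p])
    show "glue n N s s' p \<in> configs n (Suc N) s s'"
      using glue_in_configs[OF assms, of "fst p" "snd p"] p by simp
  qed
  also have "\<dots> = (\<Sum>m\<in>{..<n} \<rightarrow>\<^sub>E {-1, 1}. \<Sum>\<tau>\<in>(\<Pi>\<^sub>E c\<in>halves n. configs n N (left_end s m c) (right_end s' m c)). \<Prod>c\<in>halves n. W c (\<tau> c))"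
  proof -
    have "(\<Sum>m\<in>{..<n} \<rightarrow>\<^sub>E {-1, 1}. \<Sum>\<tau>\<in>(\<Pi>\<^sub>E c\<in>halves n. configs n N (left_end s m c) (right_end s' m c)). \<Prod>c\<in>halves n. W c (\<tau> c))
        = (\<Sum>(m, \<tau>)\<in>glued_configs n N s s'. \<Prod>c\<in>halves n. W c (\<tau> c))"
      by (rule sum.Sigma) (intro ballI finite_PiE finite_configs finite_cartesian_product finite_lessThan finite; simp)+
    thus ?thesis unfolding case_prod_unfold by (rule sym)
  qed
  also have "\<dots> = (\<Sum>m\<in>{..<n} \<rightarrow>\<^sub>E {-1, 1}. \<Prod>c\<in>halves n. Z c (left_end s m c) (right_end s' m c))"
  proof (intro sum.cong refl)
    fix m
    show "(\<Sum>\<tau>\<in>(\<Pi>\<^sub>E c\<in>halves n. configs n N (left_end s m c) (right_end s' m c)). \<Prod>c\<in>halves n. W c (\<tau> c))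
        = (\<Prod>c\<in>halves n. Z c (left_end s m c) (right_end s' m c))"
      unfolding Z[symmetric] by (rule prod_sum_PiE[where f=W, symmetric]) (auto intro: finite_configs)
  qed
  also have "\<dots> = (\<Sum>m\<in>{..<n} \<rightarrow>\<^sub>E {-1, 1}. \<Prod>i<n. Z (i, False) s (m i) * Z (i, True) (m i) s')"
    unfolding prod_halves left_end_def right_end_def snd_conv fst_conv if_True if_False ..
  also have "\<dots> = (\<Prod>i<n. \<Sum>m\<in>{-1, 1}. Z (i, False) s m * Z (i, True) m s')"
    by (rule prod_sum_PiE[where f="\<lambda>i m. Z (i, False) s m * Z (i, True) m s'", symmetric]) auto
  finally show ?thesis by (simp add: Z_def)
qed

lemma partition_function_flip: "partition_function n \<beta> N J (- s) (- s') = partition_function n \<beta> N J s s'"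
proof -
  let ?flip = "\<lambda>\<sigma>. \<lambda>v\<in>verts n N. - (\<sigma> v :: real)"
  have flip: "?flip \<sigma> \<in> configs n N (- s) (- s')" if "\<sigma> \<in> configs n N s s'" for \<sigma> s s'
    using that poles_in_verts by (auto simp: configs_def PiE_iff)
  have inv: "?flip (?flip \<sigma>) = \<sigma>" if "\<sigma> \<in> configs n N s s'" for \<sigma> s s'
    using that by (intro extensionalityI[of _ "verts n N"]) (auto simp: configs_def PiE_iff)
  show ?thesis unfolding partition_function_def
  proof (rule sum.reindex_bij_witness[of _ ?flip ?flip])
    fix \<sigma> assume \<sigma>: "\<sigma> \<in> configs n N (- s) (- s')"
    show "?flip (?flip \<sigma>) = \<sigma>" using \<sigma> by (rule inv)
    show "?flip \<sigma> \<in> configs n N s s'" using flip[OF \<sigma>] by simp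
    show "exp (\<beta> * (\<Sum>e\<in>edges n N. J e * ?flip \<sigma> (fst (endpoints e)) * ?flip \<sigma> (snd (endpoints e))))
        = exp (\<beta> * (\<Sum>e\<in>edges n N. J e * \<sigma> (fst (endpoints e)) * \<sigma> (snd (endpoints e))))"
      using endpoints_in_verts by (intro arg_cong[where f="\<lambda>x. exp (\<beta> * x)"] sum.cong) auto
  next
    fix \<sigma> assume \<sigma>: "\<sigma> \<in> configs n N s s'"
    show "?flip (?flip \<sigma>) = \<sigma>" using \<sigma> by (rule inv)
    show "?flip \<sigma> \<in> configs n N (- s) (- s')" using \<sigma> by (rule flip)
  qed
qed

lemma partition_function_pos:
  assumes "s \<in> {-1, 1}" "s' \<in> {-1, 1}"
  shows "partition_function n \<beta> N J s s' > 0"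
proof -
  have "(\<lambda>v\<in>verts n N. case v of Pole1 \<Rightarrow> s | Pole2 \<Rightarrow> s' | Mid xs i \<Rightarrow> 1) \<in> configs n N s s'"
    using assms poles_in_verts by (auto simp: configs_def split: vertex.splits)
  thus ?thesis unfolding partition_function_def by (intro sum_pos finite_configs) auto
qed

text \<open>
  With \<open>p / q = exp (2 * a)\<close> and \<open>p' / q' = exp (2 * b)\<close> numerator and denominator are the common
  factor \<open>2 * q * q' * exp (a + b)\<close> times \<open>cosh (a + b)\<close> and \<open>cosh (a - b)\<close>.
\<close>

lemma star_eff_couplings:
  fixes p q p' q' :: real
  assumes "p > 0" "q > 0" "p' > 0" "q' > 0"
  shows "ln ((p * p' + q * q') / (p * q' + q * p')) / 2 = star (ln (p / q) / 2) (ln (p' / q') / 2)"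
proof -
  define a b where "a = ln (p / q) / 2" and "b = ln (p' / q') / 2"
  have "exp (2 * a) = p / q" "exp (2 * b) = p' / q'" using assms by (auto simp: a_def b_def)
  hence ab: "p = exp (2 * a) * q" "p' = exp (2 * b) * q'" using assms by auto
  have cosh: "2 * exp x * cosh y = exp (x + y) + exp (x - y)" for x y :: real
    by (simp add: cosh_def exp_add exp_diff exp_minus divide_simps algebra_simps)
  have 1: "exp (2 * a) * exp (2 * b) + 1 = 2 * exp (a + b) * cosh (a + b)"
  proof -
    have "a + b + (a + b) = 2 * a + 2 * b" by simp
    thus ?thesis unfolding cosh by (simp add: exp_add)
  qed
  have 2: "exp (2 * a) + exp (2 * b) = 2 * exp (a + b) * cosh (a - b)"
  proof -
    have "a + b + (a - b) = 2 * a" "a + b - (a - b) = 2 * b" by simp_all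
    thus ?thesis unfolding cosh by simp
  qed
  have "(p * p' + q * q') / (p * q' + q * p') = (q * q' * (exp (2 * a) * exp (2 * b) + 1)) / (q * q' * (exp (2 * a) + exp (2 * b)))"
    unfolding ab by (simp add: algebra_simps)
  also have "\<dots> = cosh (a + b) / cosh (a - b)" using assms by (simp add: 1 2)
  finally show ?thesis by (simp add: star_def a_def b_def)
qed

lemma eff_coupling_Suc:
  "eff_coupling n \<beta> (Suc N) J
     = (\<Sum>i<n. star (eff_coupling n \<beta> N (block n N (i, False) J)) (eff_coupling n \<beta> N (block n N (i, True) J)))"
proof -
  define Z where "Z c = partition_function n \<beta> N (block n N c J)" for c
  have pos: "Z c 1 1 > 0" "Z c 1 (-1) > 0" for c by (auto simp: Z_def partition_function_pos)
  have flip: "Z c (-1) 1 = Z c 1 (-1)" "Z c (-1) (-1) = Z c 1 1" for c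
    using partition_function_flip[of n \<beta> N "block n N c J" 1 "-1"]
      partition_function_flip[of n \<beta> N "block n N c J" 1 1] by (simp_all add: Z_def)
  define P where "P i = Z (i, False) 1 1 * Z (i, True) 1 1 + Z (i, False) 1 (-1) * Z (i, True) 1 (-1)" for i
  define Q where "Q i = Z (i, False) 1 1 * Z (i, True) 1 (-1) + Z (i, False) 1 (-1) * Z (i, True) 1 1" for i
  have PQ: "P i > 0" "Q i > 0" for i unfolding P_def Q_def by (intro add_pos_pos mult_pos_pos pos)+
  have "partition_function n \<beta> (Suc N) J 1 1 = (\<Prod>i<n. P i)"
    by (subst partition_function_Suc) (auto simp: P_def Z_def[symmetric] flip add.commute)
  moreover have "partition_function n \<beta> (Suc N) J 1 (-1) = (\<Prod>i<n. Q i)"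
    by (subst partition_function_Suc) (auto simp: Q_def Z_def[symmetric] flip add.commute)
  ultimately have "eff_coupling n \<beta> (Suc N) J = ln (\<Prod>i<n. P i / Q i) / 2"
    by (simp add: eff_coupling_def prod_dividef)
  also have "\<dots> = (\<Sum>i<n. ln (P i / Q i) / 2)"
    using PQ[THEN less_imp_neq] by (subst ln_prod) (auto simp: sum_divide_distrib)
  also have "\<dots> = (\<Sum>i<n. star (eff_coupling n \<beta> N (block n N (i, False) J)) (eff_coupling n \<beta> N (block n N (i, True) J)))"
    by (intro sum.cong refl) (simp add: P_def Q_def eff_coupling_def Z_def[symmetric] star_eff_couplings[OF pos pos])
  finally show ?thesis .
qed

section \<open>A single branch\<close>

lemma star_commute: "star a b = star b a"
  using cosh_minus[of "a - b"] by (simp add: star_def add.commute)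

lemma star_minus_right: "star a (- b) = - star a b"
  by (simp add: star_def ln_div cosh_real_pos) (simp add: field_simps)

lemma star_measurable [measurable (raw)]:
  assumes [measurable]: "f \<in> borel_measurable M" "g \<in> borel_measurable M"
  shows "(\<lambda>x. star (f x) (g x)) \<in> borel_measurable M"
  unfolding star_def cosh_def by measurable

lemma star_has_derivative:
  "((\<lambda>a. star a b) has_real_derivative (tanh (a + b) - tanh (a - b)) / 2) (at a)"
proof -
  have "(\<lambda>a. star a b) = (\<lambda>a. (ln (cosh (a + b)) - ln (cosh (a - b))) / 2)"
    by (simp add: star_def ln_div cosh_real_pos fun_eq_iff)
  moreover have "((\<lambda>a. (ln (cosh (a + b)) - ln (cosh (a - b))) / 2) has_real_derivative (tanh (a + b) - tanh (a - b)) / 2) (at a)"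
    by (auto intro!: derivative_eq_intros simp: cosh_real_pos tanh_def divide_simps)
  ultimately show ?thesis by simp
qed

text \<open>
  The left-hand side is \<open>tanh R * (1 + tanh L) / 2\<close>, hence at most \<open>(tanh R + tanh L) / 2\<close>; the
  right-hand side is \<open>(tanh (b + \<bar>a\<bar>) + tanh (b - \<bar>a\<bar>)) / 2\<close>, where the arguments are at least
  \<open>R\<close> and \<open>L\<close>.
\<close>

lemma tanh_average_ge:
  fixes a b L R :: real
  assumes "L > 0" "R > 0" "b \<ge> R" "\<bar>a\<bar> \<le> b - L"
  shows "tanh R / (1 + exp (- 2 * L)) \<le> (tanh (a + b) - tanh (a - b)) / 2"
proof -
  have "1 / (1 + exp (- 2 * L)) = (1 + tanh L) / 2"
  proof -
    have "exp (- 2 * L) > 0" by simp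
    hence "1 + exp (- 2 * L) \<noteq> 0" by linarith
    thus ?thesis by (simp add: tanh_real_altdef field_simps)
  qed
  hence "tanh R / (1 + exp (- 2 * L)) = tanh R * ((1 + tanh L) / 2)"
    by (metis mult.commute mult.left_neutral times_divide_eq_left)
  also have "\<dots> \<le> (tanh R + tanh L) / 2"
    using mult_right_mono[of "tanh R" 1 "tanh L"] tanh_real_lt_1[of R] assms by (simp add: algebra_simps)
  also have "\<dots> \<le> (tanh (b + \<bar>a\<bar>) + tanh (b - \<bar>a\<bar>)) / 2"
  proof -
    have "tanh R \<le> tanh (b + \<bar>a\<bar>)" "tanh L \<le> tanh (b - \<bar>a\<bar>)" using assms by auto
    thus ?thesis by (intro divide_right_mono add_mono) auto
  qed
  also have "\<dots> = (tanh (a + b) - tanh (a - b)) / 2"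
  proof -
    have "tanh (a - b) = - tanh (b - a)" using tanh_minus[of "b - a"] by simp
    thus ?thesis by (cases "a \<ge> 0") (auto simp: add.commute)
  qed
  finally show ?thesis .
qed

text \<open>
  On the interval \<open>\<bar>a\<bar> \<le> b - L\<close> the map \<open>a \<mapsto> \<Lambda> * star a b\<close> has slope at least \<open>r\<close>, so by change of
  variables it shrinks no set by more than this factor.
\<close>

lemma star_slice_length_pos:
  assumes LR: "L > 0" "R > 0" and b: "b \<ge> R" and r: "r > 0"
    and \<Lambda>: "\<Lambda> = r * ((1 + exp (- 2 * L)) / tanh R)" and S[measurable]: "S \<in> sets borel"
  shows "ennreal r * emeasure lborel {a. \<bar>a\<bar> \<le> b - L \<and> \<Lambda> * star a b \<in> S} \<le> emeasure lborel S"
proof (cases "L \<le> b")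
  case False
  hence empty: "{a. \<bar>a\<bar> \<le> b - L \<and> \<Lambda> * star a b \<in> S} = {}" by auto
  show ?thesis unfolding empty by simp
next
  case True
  define g where "g a = \<Lambda> * star a b" for a
  define g' where "g' a = \<Lambda> * ((tanh (a + b) - tanh (a - b)) / 2)" for a
  have e: "1 + exp (- 2 * L) > 0" by (intro add_pos_pos) auto
  have scale_pos: "\<Lambda> > 0" unfolding \<Lambda> using r LR e by (intro mult_pos_pos divide_pos_pos) auto
  have ge: "r \<le> g' a" if "a \<in> {- (b - L)..b - L}" for a
  proof -
    have "r = \<Lambda> * (tanh R / (1 + exp (- 2 * L)))" using LR e by (simp add: \<Lambda>)
    also have "\<dots> \<le> g' a"
      unfolding g'_def using that scale_pos by (intro mult_left_mono tanh_average_ge LR b) auto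
    finally show ?thesis .
  qed
  have [measurable]: "g \<in> borel_measurable borel" unfolding g_def[abs_def] by measurable
  have [measurable]: "{a. \<bar>a\<bar> \<le> b - L \<and> \<Lambda> * star a b \<in> S} \<in> sets borel" by measurable
  have "ennreal r * emeasure lborel {a. \<bar>a\<bar> \<le> b - L \<and> \<Lambda> * star a b \<in> S}
      = (\<integral>\<^sup>+a. ennreal r * indicator {a. \<bar>a\<bar> \<le> b - L \<and> \<Lambda> * star a b \<in> S} a \<partial>lborel)"
    by (rule nn_integral_cmult_indicator[symmetric]) measurable
  also have "\<dots> \<le> (\<integral>\<^sup>+a. ennreal (indicator S (g a) * g' a * indicator {- (b - L)..b - L} a) \<partial>lborel)"
    using ge by (intro nn_integral_mono) (auto simp: indicator_def g_def intro!: ennreal_leI)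
  also have "\<dots> = (\<integral>\<^sup>+x. ennreal (indicator S x * indicator {g (- (b - L))..g (b - L)} x) \<partial>lborel)"
  proof (rule nn_integral_substitution[symmetric])
    show "set_borel_measurable borel {g (- (b - L))..g (b - L)} (indicator S :: real \<Rightarrow> real)"
      unfolding set_borel_measurable_def
      by (intro borel_measurable_scaleR borel_measurable_indicator) (auto simp: S)
    show "(g has_real_derivative g' a) (at a)" for a
      unfolding g_def g'_def by (intro DERIV_cmult star_has_derivative)
    show "continuous_on {- (b - L)..b - L} g'"
      unfolding g'_def by (intro continuous_intros) auto
    show "0 \<le> g' a" if "a \<in> {- (b - L)..b - L}" for a using ge[OF that] r by linarith
  qed (use True in auto)
  also have "\<dots> \<le> (\<integral>\<^sup>+x. indicator S x \<partial>lborel)"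
    by (intro nn_integral_mono) (auto simp: indicator_def)
  finally show ?thesis by simp
qed

lemma star_slice_length:
  assumes LR: "L > 0" "R > 0" and b: "\<bar>b\<bar> \<ge> R" and r: "r > 0"
    and \<Lambda>: "\<Lambda> = r * ((1 + exp (- 2 * L)) / tanh R)" and S[measurable]: "S \<in> sets borel"
  shows "ennreal r * emeasure lborel {a. \<bar>a\<bar> \<le> \<bar>b\<bar> - L \<and> \<Lambda> * star a b \<in> S} \<le> emeasure lborel S"
proof (cases "b \<ge> 0")
  case True
  thus ?thesis using star_slice_length_pos[OF LR _ r \<Lambda> S] b by simp
next
  case False
  have S': "uminus -` S \<in> sets borel" using measurable_sets[OF borel_measurable_uminus[OF measurable_ident] S] by simp
  have "emeasure lborel (uminus -` S) = emeasure lborel S"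
  proof -
    have "emeasure lborel S = (\<integral>\<^sup>+x. indicator S (0 - x) \<partial>lborel)"
      using nn_integral_reflect[of "indicator S" 0] by simp
    also have "\<dots> = (\<integral>\<^sup>+x. indicator (uminus -` S) x \<partial>lborel)"
      by (intro nn_integral_cong) (auto simp: indicator_def)
    finally show ?thesis using S' by simp
  qed
  moreover have "\<Lambda> * star a b \<in> S \<longleftrightarrow> \<Lambda> * star a (- b) \<in> uminus -` S" for a
    by (simp add: star_minus_right)
  ultimately show ?thesis using star_slice_length_pos[OF LR _ r \<Lambda> S', of "- b"] b False by simp
qed

text \<open>
  The triangle \<open>p2\<close> is the convolution of two uniform densities of height \<open>2\<close> on \<open>[-1/4, 1/4]\<close>, so
  its excess is known from centred overlaps.
\<close>

lemma p2_eq_overlap: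
  "ennreal (p2 y) = 4 * (\<integral>\<^sup>+x. centred (1 / 2) (x + y) * centred (1 / 2) x \<partial>lborel)"
proof -
  have "emeasure lborel {max (- (1 / 2) / 2) (- (1 / 2) / 2 - y)..min ((1 / 2) / 2) ((1 / 2) / 2 - y)} = ennreal (p2 y / 4)"
    by (cases "y \<ge> 0") (auto simp: p2_def max_def min_def ennreal_neg)
  moreover have "ennreal (p2 y) = 4 * ennreal (p2 y / 4)"
    using p2_nonneg[of y] ennreal_mult[of 4 "p2 y / 4"] by simp
  ultimately show ?thesis unfolding centred_overlap by simp
qed

lemma p2_excess:
  assumes "0 \<le> t" "t \<le> 2"
  shows "ennreal ((1 - t / 2)\<^sup>2) \<le> (\<integral>\<^sup>+y. (ennreal (p2 y) - ennreal t) \<partial>lborel)"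
proof -
  define k where "k y = (\<integral>\<^sup>+x. centred (1 / 2) (x + y) * centred (1 / 2) x \<partial>lborel)" for y
  have [measurable]: "centred (1 / 2) \<in> borel_measurable borel" by (simp add: centred_def)
  have [measurable]: "k \<in> borel_measurable borel" unfolding k_def[abs_def] by measurable
  have scale: "4 * (c - ennreal (t / 4)) = 4 * c - ennreal t" for c
  proof (cases c)
    case (real d)
    have 4: "(4::ennreal) = ennreal 4" by simp
    show ?thesis using real \<open>t \<ge> 0\<close> unfolding 4 real
      by (simp add: ennreal_minus ennreal_mult'[symmetric] algebra_simps del: ennreal_numeral)
  qed (simp add: ennreal_mult_top)
  have "ennreal ((1 - t / 2)\<^sup>2) = 4 * ((ennreal (1 / 2) - ennreal (t / 4)) * (ennreal (1 / 2) - ennreal (t / 4)))"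
  proof -
    have 4: "(4::ennreal) = ennreal 4" by simp
    have "(1 - t / 2)\<^sup>2 = 4 * ((1 / 2 - t / 4) * (1 / 2 - t / 4))" by (simp add: power2_eq_square field_simps)
    moreover have "ennreal (1 / 2) - ennreal (t / 4) = ennreal (1 / 2 - t / 4)"
      using assms by (intro ennreal_minus) auto
    ultimately show ?thesis using assms unfolding 4
      by (simp only: ennreal_mult[symmetric] divide_nonneg_nonneg) (simp add: ennreal_mult)
  qed
  also have "\<dots> \<le> 4 * (\<integral>\<^sup>+y. (k y - ennreal (t / 4)) \<partial>lborel)"
    unfolding k_def using assms by (intro mult_left_mono centred_overlap_excess_ge) auto
  also have "\<dots> = (\<integral>\<^sup>+y. 4 * (k y - ennreal (t / 4)) \<partial>lborel)"
    by (rule nn_integral_cmult[symmetric]) measurable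
  also have "\<dots> = (\<integral>\<^sup>+y. (ennreal (p2 y) - ennreal t) \<partial>lborel)"
    by (simp add: scale p2_eq_overlap k_def[symmetric])
  finally show ?thesis .
qed

text \<open>
  The condition with \<open>R\<close> keeps the half of larger modulus away from \<open>0\<close>, that with \<open>L\<close> keeps the
  moduli apart; together they make \<open>star\<close> expand in the half of smaller modulus.
\<close>

definition good_pairs :: "'a measure \<Rightarrow> 'a set \<Rightarrow> ('a \<Rightarrow> real) \<Rightarrow> real \<Rightarrow> real \<Rightarrow> ('a \<times> 'a) set" where
  "good_pairs M E \<xi> R L = {p\<in>space (M \<Otimes>\<^sub>M M). fst p \<in> E \<and> snd p \<in> E
     \<and> R < max \<bar>\<xi> (fst p)\<bar> \<bar>\<xi> (snd p)\<bar> \<and> L < \<bar>\<bar>\<xi> (fst p)\<bar> - \<bar>\<xi> (snd p)\<bar>\<bar>}"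

locale bounded_on_event = prob_space +
  fixes E :: "'a set" and \<xi> :: "'a \<Rightarrow> real" and r :: real
  assumes E [measurable]: "E \<in> events" and \<xi> [measurable]: "\<xi> \<in> borel_measurable M" and r: "r > 0"
    and density: "S \<in> sets borel \<Longrightarrow> emeasure M {x\<in>space M. x \<in> E \<and> \<xi> x \<in> S} \<le> ennreal r * emeasure lborel S"
begin

sublocale two: pair_prob_space M M ..

lemma emeasure_pair_sections:
  assumes [measurable]: "Measurable.pred (M \<Otimes>\<^sub>M M) P"
  shows "emeasure (M \<Otimes>\<^sub>M M) {p\<in>space (M \<Otimes>\<^sub>M M). P p} = (\<integral>\<^sup>+y. emeasure M {x\<in>space M. P (x, y)} \<partial>M)"
    "emeasure (M \<Otimes>\<^sub>M M) {p\<in>space (M \<Otimes>\<^sub>M M). P p} = (\<integral>\<^sup>+x. emeasure M {y\<in>space M. P (x, y)} \<partial>M)"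
proof -
  have "(\<lambda>x. (x, y)) -` {p\<in>space (M \<Otimes>\<^sub>M M). P p} = {x\<in>space M. P (x, y)}" if "y \<in> space M" for y
    using that by (auto simp: space_pair_measure)
  thus "emeasure (M \<Otimes>\<^sub>M M) {p\<in>space (M \<Otimes>\<^sub>M M). P p} = (\<integral>\<^sup>+y. emeasure M {x\<in>space M. P (x, y)} \<partial>M)"
    by (subst two.emeasure_pair_measure_alt2) (auto intro!: nn_integral_cong)
  have "Pair x -` {p\<in>space (M \<Otimes>\<^sub>M M). P p} = {y\<in>space M. P (x, y)}" if "x \<in> space M" for x
    using that by (auto simp: space_pair_measure)
  thus "emeasure (M \<Otimes>\<^sub>M M) {p\<in>space (M \<Otimes>\<^sub>M M). P p} = (\<integral>\<^sup>+x. emeasure M {y\<in>space M. P (x, y)} \<partial>M)"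
    by (subst emeasure_pair_measure_alt) (auto intro!: nn_integral_cong)
qed

lemma emeasure_rectangle:
  assumes [measurable]: "Measurable.pred M A"
  shows "emeasure (M \<Otimes>\<^sub>M M) {p\<in>space (M \<Otimes>\<^sub>M M). A (fst p) \<and> A (snd p)} = (emeasure M {x\<in>space M. A x})\<^sup>2"
proof -
  have "{p\<in>space (M \<Otimes>\<^sub>M M). A (fst p) \<and> A (snd p)} = {x\<in>space M. A x} \<times> {x\<in>space M. A x}"
    by (auto simp: space_pair_measure)
  thus ?thesis by (simp add: emeasure_pair_measure_Times power2_eq_square)
qed

lemma good_pairs_measurable [measurable]: "good_pairs M E \<xi> R L \<in> sets (M \<Otimes>\<^sub>M M)"
  unfolding good_pairs_def by measurable

text \<open>
  Here \<open>y\<close> is the half of larger modulus. Conditionally on it, \<open>P\<close> confines the value of the other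
  half to the set \<open>B y\<close>. The two bounds are for the two possible positions of that half.
\<close>

lemma larger_half_bound:
  assumes [measurable]: "Measurable.pred M A" "Measurable.pred (M \<Otimes>\<^sub>M M) P" "\<And>y. B y \<in> sets borel"
    and P: "\<And>x y. P (x, y) \<Longrightarrow> x \<in> E \<and> A y \<and> \<xi> x \<in> B y"
    and B: "\<And>y. A y \<Longrightarrow> ennreal r * emeasure lborel (B y) \<le> l"
  shows "emeasure (M \<Otimes>\<^sub>M M) {p\<in>space (M \<Otimes>\<^sub>M M). P p} \<le> l * emeasure M {y\<in>space M. A y}"
    "emeasure (M \<Otimes>\<^sub>M M) {p\<in>space (M \<Otimes>\<^sub>M M). P (snd p, fst p)} \<le> l * emeasure M {y\<in>space M. A y}"
proof -
  have *: "emeasure M {x\<in>space M. P (x, y)} \<le> l * indicator {y\<in>space M. A y} y" if y: "y \<in> space M" for y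
  proof (cases "A y")
    case True
    have "emeasure M {x\<in>space M. P (x, y)} \<le> emeasure M {x\<in>space M. x \<in> E \<and> \<xi> x \<in> B y}"
      using P by (intro emeasure_mono) auto
    also have "\<dots> \<le> ennreal r * emeasure lborel (B y)" by (rule density) measurable
    finally show ?thesis using B[OF True] True y by (simp add: indicator_def)
  next
    case False
    hence empty: "{x\<in>space M. P (x, y)} = {}" using P by auto
    show ?thesis unfolding empty by simp
  qed
  have int: "(\<integral>\<^sup>+y. emeasure M {x\<in>space M. P (x, y)} \<partial>M) \<le> l * emeasure M {y\<in>space M. A y}"
    by (subst nn_integral_cmult_indicator[symmetric]) (auto intro!: nn_integral_mono *)
  show "emeasure (M \<Otimes>\<^sub>M M) {p\<in>space (M \<Otimes>\<^sub>M M). P p} \<le> l * emeasure M {y\<in>space M. A y}"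
    using int by (subst emeasure_pair_sections(1)) auto
  have "emeasure (M \<Otimes>\<^sub>M M) {p\<in>space (M \<Otimes>\<^sub>M M). P (snd p, fst p)} = (\<integral>\<^sup>+y. emeasure M {x\<in>space M. P (x, y)} \<partial>M)"
    by (subst emeasure_pair_sections(2)) auto
  thus "emeasure (M \<Otimes>\<^sub>M M) {p\<in>space (M \<Otimes>\<^sub>M M). P (snd p, fst p)} \<le> l * emeasure M {y\<in>space M. A y}"
    using int by simp
qed

context
  fixes L R :: real
  assumes LR: "L > 0" "R > 0"
begin

text \<open>
  The factor makes the slope in the smaller half at least \<open>r\<close>, the bound on its density; the law
  can then be compared with the triangle \<open>p2\<close> itself rather than with a scaled copy.
\<close>

definition scaled_branch :: "'a \<times> 'a \<Rightarrow> real" where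
  "scaled_branch p = r * ((1 + exp (- 2 * L)) / tanh R) * star (\<xi> (fst p)) (\<xi> (snd p))"

lemma scaled_branch_measurable [measurable]: "scaled_branch \<in> borel_measurable (M \<Otimes>\<^sub>M M)"
  unfolding scaled_branch_def[abs_def] by measurable

text \<open>
  Either both moduli are at most \<open>c\<close>, or the larger one exceeds \<open>c\<close> and the smaller one is confined
  to a slice in which it lies with probability at most \<open>emeasure lborel S\<close>.
\<close>

lemma branch_split:
  assumes [measurable]: "S \<in> sets borel"
  shows "emeasure (restricted_law (M \<Otimes>\<^sub>M M) (good_pairs M E \<xi> R L) scaled_branch) S
    \<le> (emeasure M {x\<in>space M. x \<in> E \<and> \<bar>\<xi> x\<bar> \<le> c})\<^sup>2 + 2 * (emeasure lborel S * emeasure M {x\<in>space M. x \<in> E \<and> c < \<bar>\<xi> x\<bar>})"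
proof -
  let ?\<Lambda> = "r * ((1 + exp (- 2 * L)) / tanh R)"
  let ?A = "\<lambda>y. y \<in> E \<and> c < \<bar>\<xi> y\<bar> \<and> R \<le> \<bar>\<xi> y\<bar>"
  let ?B = "\<lambda>y. {a. \<bar>a\<bar> \<le> \<bar>\<xi> y\<bar> - L \<and> ?\<Lambda> * star a (\<xi> y) \<in> S}"
  let ?P = "\<lambda>p. fst p \<in> E \<and> ?A (snd p) \<and> \<bar>\<xi> (fst p)\<bar> \<le> \<bar>\<xi> (snd p)\<bar> - L \<and> ?\<Lambda> * star (\<xi> (fst p)) (\<xi> (snd p)) \<in> S"
  let ?N = "M \<Otimes>\<^sub>M M"
  define l where "l = emeasure lborel S * emeasure M {x\<in>space M. x \<in> E \<and> c < \<bar>\<xi> x\<bar>}"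
  have le: "emeasure lborel S * emeasure M {y\<in>space M. ?A y} \<le> l"
    unfolding l_def by (intro mult_left_mono emeasure_mono) auto
  have slice: "ennreal r * emeasure lborel (?B y) \<le> emeasure lborel S" if "?A y" for y
    using that by (intro star_slice_length[OF LR _ r refl]) auto
  note bound = larger_half_bound[of ?A ?P ?B "emeasure lborel S", OF _ _ _ _ slice]
  have 1: "emeasure ?N {p\<in>space ?N. ?P p} \<le> l"
    by (rule order_trans[OF bound(1) le]) auto
  have 2: "emeasure ?N {p\<in>space ?N. ?P (snd p, fst p)} \<le> l"
    by (rule order_trans[OF bound(2) le]) auto
  let ?C = "{p\<in>space ?N. (fst p \<in> E \<and> \<bar>\<xi> (fst p)\<bar> \<le> c) \<and> (snd p \<in> E \<and> \<bar>\<xi> (snd p)\<bar> \<le> c)}"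
  have "emeasure (restricted_law ?N (good_pairs M E \<xi> R L) scaled_branch) S
      = emeasure ?N {p\<in>space ?N. p \<in> good_pairs M E \<xi> R L \<and> scaled_branch p \<in> S}"
    by (rule emeasure_restricted_law) measurable
  also have "\<dots> \<le> emeasure ?N (?C \<union> ({p\<in>space ?N. ?P p} \<union> {p\<in>space ?N. ?P (snd p, fst p)}))"
  proof (rule emeasure_mono)
    show "{p\<in>space ?N. p \<in> good_pairs M E \<xi> R L \<and> scaled_branch p \<in> S}
        \<subseteq> ?C \<union> ({p\<in>space ?N. ?P p} \<union> {p\<in>space ?N. ?P (snd p, fst p)})"
    proof
      fix p assume "p \<in> {p\<in>space ?N. p \<in> good_pairs M E \<xi> R L \<and> scaled_branch p \<in> S}"
      hence p: "p \<in> space ?N" "fst p \<in> E" "snd p \<in> E" "R < max \<bar>\<xi> (fst p)\<bar> \<bar>\<xi> (snd p)\<bar>"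
          "L < \<bar>\<bar>\<xi> (fst p)\<bar> - \<bar>\<xi> (snd p)\<bar>\<bar>" "?\<Lambda> * star (\<xi> (fst p)) (\<xi> (snd p)) \<in> S"
        by (auto simp: good_pairs_def scaled_branch_def)
      show "p \<in> ?C \<union> ({p\<in>space ?N. ?P p} \<union> {p\<in>space ?N. ?P (snd p, fst p)})"
      proof (cases "\<bar>\<xi> (fst p)\<bar> \<le> c \<and> \<bar>\<xi> (snd p)\<bar> \<le> c")
        case True
        thus ?thesis using p by auto
      next
        case False
        show ?thesis
        proof (cases "\<bar>\<xi> (fst p)\<bar> \<le> \<bar>\<xi> (snd p)\<bar>")
          case True
          hence "?P p" using p False LR by auto
          thus ?thesis using p by blast
        next
          case F: False
          have "?\<Lambda> * star (\<xi> (snd p)) (\<xi> (fst p)) \<in> S" using p(6) by (simp only: star_commute)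
          hence "?P (snd p, fst p)" using p(1-5) False F LR by auto
          thus ?thesis using p by blast
        qed
      qed
    qed
  qed measurable
  also have "\<dots> \<le> emeasure ?N ?C + (emeasure ?N {p\<in>space ?N. ?P p} + emeasure ?N {p\<in>space ?N. ?P (snd p, fst p)})"
    by (rule order_trans[OF emeasure_subadditive add_left_mono[OF emeasure_subadditive]]) measurable
  also have "emeasure ?N ?C = (emeasure M {x\<in>space M. x \<in> E \<and> \<bar>\<xi> x\<bar> \<le> c})\<^sup>2"
    by (rule emeasure_rectangle) measurable
  also have "(emeasure M {x\<in>space M. x \<in> E \<and> \<bar>\<xi> x\<bar> \<le> c})\<^sup>2 + (emeasure ?N {p\<in>space ?N. ?P p} + emeasure ?N {p\<in>space ?N. ?P (snd p, fst p)})
      \<le> (emeasure M {x\<in>space M. x \<in> E \<and> \<bar>\<xi> x\<bar> \<le> c})\<^sup>2 + 2 * l"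
    unfolding mult_2 by (intro add_left_mono add_mono 1 2)
  finally show ?thesis by (simp only: l_def)
qed

lemma ex_abs_cut:
  assumes "0 < u" "u < prob E"
  obtains c where "emeasure M {x\<in>space M. x \<in> E \<and> \<bar>\<xi> x\<bar> \<le> c} = ennreal u"
    "emeasure M {x\<in>space M. x \<in> E \<and> c < \<bar>\<xi> x\<bar>} = ennreal (prob E - u)"
proof -
  define \<eta> where "\<eta> = restricted_law M E (\<lambda>x. \<bar>\<xi> x\<bar>)"
  have \<eta>: "emeasure \<eta> S = emeasure M {x\<in>space M. x \<in> E \<and> \<bar>\<xi> x\<bar> \<in> S}" if "S \<in> sets borel" for S
    unfolding \<eta>_def using that by (intro emeasure_restricted_law) auto
  have fin: "finite_measure \<eta>" unfolding \<eta>_def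
    by (rule finite_measure_restricted_law) (auto intro: finite_measure_axioms)
  then interpret \<eta>: finite_measure \<eta> .
  have null: "measure \<eta> {c} = 0" for c
  proof -
    have "emeasure \<eta> {c} = emeasure M {x\<in>space M. x \<in> E \<and> \<bar>\<xi> x\<bar> \<in> {c}}" by (rule \<eta>) simp
    also have "\<dots> \<le> emeasure M {x\<in>space M. x \<in> E \<and> \<xi> x \<in> {c, - c}}"
      by (intro emeasure_mono) auto
    also have "\<dots> \<le> ennreal r * emeasure lborel {c, - c}" by (rule density) auto
    also have "\<dots> = 0" by (simp add: emeasure_lborel_countable)
    finally show ?thesis by (simp add: measure_def)
  qed
  have "{x\<in>space M. x \<in> E} = E" using sets.sets_into_space[OF E] by auto
  hence "emeasure \<eta> UNIV = ennreal (prob E)" using \<eta>[of UNIV] by (simp add: emeasure_eq_measure)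
  hence "measure \<eta> UNIV = prob E" by (simp add: measure_def)
  then obtain c where c: "measure \<eta> {..c} = u"
    using ex_cut_point[OF fin _ null, of u] assms by (auto simp: \<eta>_def)
  have 1: "emeasure M {x\<in>space M. x \<in> E \<and> \<bar>\<xi> x\<bar> \<le> c} = ennreal u"
    using \<eta>[of "{..c}"] c by (simp add: \<eta>.emeasure_eq_measure)
  have "{x\<in>space M. x \<in> E \<and> c < \<bar>\<xi> x\<bar>} = E - {x\<in>space M. x \<in> E \<and> \<bar>\<xi> x\<bar> \<le> c}"
    using sets.sets_into_space[OF E] by auto
  hence "emeasure M {x\<in>space M. x \<in> E \<and> c < \<bar>\<xi> x\<bar>} = emeasure M E - emeasure M {x\<in>space M. x \<in> E \<and> \<bar>\<xi> x\<bar> \<le> c}"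
    by (simp only:) (rule emeasure_Diff, auto simp: emeasure_eq_measure)
  also have "\<dots> = ennreal (prob E - u)" using assms by (simp add: 1 emeasure_eq_measure[of E] ennreal_minus)
  finally show ?thesis using that 1 by blast
qed

text \<open>
  Let \<open>q = t / 2\<close> and choose \<open>c\<close> such that the modulus is at most \<open>c\<close> with probability \<open>1 - q\<close> on
  \<open>E\<close>. The preceding bound becomes \<open>(1 - q)\<^sup>2 + 2 * q * emeasure lborel S\<close>, and \<open>(1 - q)\<^sup>2\<close> is the
  excess of \<open>p2\<close> above \<open>t\<close>. If \<open>E\<close> has probability at most \<open>1 - q\<close>, the total mass is already at most
  \<open>(1 - q)\<^sup>2\<close>; for \<open>t \<ge> 2\<close> every \<open>c < 0\<close> serves.
\<close>

lemma branch_majorized: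
  "majorized (restricted_law (M \<Otimes>\<^sub>M M) (good_pairs M E \<xi> R L) scaled_branch) (\<lambda>x. ennreal (p2 x))"
  unfolding majorized_def
proof (intro ballI allI impI)
  fix S :: "real set" and t :: real
  assume S: "S \<in> sets borel" and t: "0 \<le> t"
  let ?\<nu> = "restricted_law (M \<Otimes>\<^sub>M M) (good_pairs M E \<xi> R L) scaled_branch"
  let ?I = "\<integral>\<^sup>+x. (ennreal (p2 x) - ennreal t) \<partial>lborel"
  note split = branch_split[OF S]
  have EE: "emeasure M {x\<in>space M. x \<in> E} = ennreal (prob E)"
    using sets.sets_into_space[OF E] by (auto simp: emeasure_eq_measure intro!: arg_cong[of _ _ prob])
  consider "t \<ge> 2" | "t < 2" "prob E \<le> 1 - t / 2" | "t < 2" "1 - t / 2 < prob E" by linarith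
  thus "emeasure ?\<nu> S \<le> ennreal t * emeasure lborel S + ?I"
  proof cases
    case 1
    have empty: "{x\<in>space M. x \<in> E \<and> \<bar>\<xi> x\<bar> \<le> - 1} = {}" by auto
    have "emeasure ?\<nu> S \<le> 2 * (emeasure lborel S * emeasure M {x\<in>space M. x \<in> E \<and> - 1 < \<bar>\<xi> x\<bar>})"
      using split[of "-1"] unfolding empty by simp
    also have "\<dots> \<le> 2 * (emeasure lborel S * 1)"
      by (intro mult_left_mono measure_le_1) auto
    also have "\<dots> \<le> ennreal t * emeasure lborel S"
      using ennreal_leI[OF 1] by (auto intro: mult_right_mono)
    finally show ?thesis by (rule order_trans) simp
  next
    case 2
    have "emeasure ?\<nu> S \<le> emeasure ?\<nu> UNIV" by (rule emeasure_mono) auto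
    also have "\<dots> = emeasure (M \<Otimes>\<^sub>M M) {p\<in>space (M \<Otimes>\<^sub>M M). p \<in> good_pairs M E \<xi> R L \<and> scaled_branch p \<in> UNIV}"
      by (rule emeasure_restricted_law) measurable
    also have "\<dots> \<le> emeasure (M \<Otimes>\<^sub>M M) {p\<in>space (M \<Otimes>\<^sub>M M). fst p \<in> E \<and> snd p \<in> E}"
      by (rule emeasure_mono) (auto simp: good_pairs_def)
    also have "\<dots> = (emeasure M {x\<in>space M. x \<in> E})\<^sup>2" by (rule emeasure_rectangle) measurable
    also have "\<dots> = ennreal ((prob E)\<^sup>2)" by (simp add: EE ennreal_power)
    also have "\<dots> \<le> ennreal ((1 - t / 2)\<^sup>2)" using 2 by (intro ennreal_leI power_mono) auto
    also have "\<dots> \<le> ?I" using 2 t by (intro p2_excess) auto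
    finally show ?thesis by (rule order_trans) simp
  next
    case 3
    obtain c where c: "emeasure M {x\<in>space M. x \<in> E \<and> \<bar>\<xi> x\<bar> \<le> c} = ennreal (1 - t / 2)"
      "emeasure M {x\<in>space M. x \<in> E \<and> c < \<bar>\<xi> x\<bar>} = ennreal (prob E - (1 - t / 2))"
      using ex_abs_cut[of "1 - t / 2"] 3 by auto
    have "emeasure ?\<nu> S \<le> ennreal ((1 - t / 2)\<^sup>2) + 2 * (emeasure lborel S * ennreal (prob E - (1 - t / 2)))"
      using split[of c] 3 by (simp add: c ennreal_power)
    also have "\<dots> \<le> ?I + 2 * (emeasure lborel S * ennreal (t / 2))"
      using 3 t by (intro add_mono p2_excess mult_left_mono ennreal_leI) auto
    also have "2 * (emeasure lborel S * ennreal (t / 2)) = ennreal t * emeasure lborel S"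
      using t ennreal_mult[of 2 "t / 2"] by (simp add: ac_simps)
    finally show ?thesis by (simp add: add.commute)
  qed
qed

text \<open>
  A pair is bad because a half leaves \<open>E\<close>, because both moduli are at most \<open>R\<close>, or because the first
  value lies in one of two intervals of length \<open>2 L\<close> determined by the second.
\<close>

lemma bad_pairs_bound:
  assumes w: "prob (space M - E) \<le> w" "w \<ge> 0"
  shows "emeasure (M \<Otimes>\<^sub>M M) (space (M \<Otimes>\<^sub>M M) - good_pairs M E \<xi> R L) \<le> ennreal (2 * w + (2 * r * R)\<^sup>2 + 4 * r * L)"
proof -
  let ?N = "M \<Otimes>\<^sub>M M"
  let ?D1 = "{p\<in>space ?N. fst p \<notin> E}" and ?D2 = "{p\<in>space ?N. snd p \<notin> E}"
  let ?C = "{p\<in>space ?N. (fst p \<in> E \<and> \<xi> (fst p) \<in> {- R..R}) \<and> (snd p \<in> E \<and> \<xi> (snd p) \<in> {- R..R})}"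
  let ?B = "\<lambda>y. {\<bar>\<xi> y\<bar> - L..\<bar>\<xi> y\<bar> + L} \<union> {- \<bar>\<xi> y\<bar> - L..- \<bar>\<xi> y\<bar> + L}"
  let ?P = "\<lambda>p. fst p \<in> E \<and> \<bar>\<bar>\<xi> (fst p)\<bar> - \<bar>\<xi> (snd p)\<bar>\<bar> \<le> L"
  have [simp]: "space M - E \<in> events" by simp
  have "{x\<in>space M. x \<notin> E} = space M - E" by auto
  hence nE: "emeasure M {x\<in>space M. x \<notin> E} \<le> ennreal w"
    using w by (simp add: emeasure_eq_measure ennreal_leI)
  have D1: "emeasure ?N ?D1 \<le> ennreal w"
    using nE by (subst emeasure_pair_sections(1)) (auto simp: emeasure_space_1)
  have D2: "emeasure ?N ?D2 \<le> ennreal w"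
    using nE by (subst emeasure_pair_sections(2)) (auto simp: emeasure_space_1)
  have "emeasure ?N ?C = (emeasure M {x\<in>space M. x \<in> E \<and> \<xi> x \<in> {- R..R}})\<^sup>2"
    by (rule emeasure_rectangle) measurable
  also have "\<dots> \<le> (ennreal r * emeasure lborel {- R..R})\<^sup>2"
    by (intro power_mono density) auto
  also have "\<dots> = ennreal ((2 * r * R)\<^sup>2)"
    using LR r by (simp add: ennreal_mult'[symmetric] ennreal_power mult_ac)
  finally have C: "emeasure ?N ?C \<le> ennreal ((2 * r * R)\<^sup>2)" .
  have "emeasure lborel (?B y) \<le> ennreal (4 * L)" for y
    by (rule order_trans[OF emeasure_subadditive]) (use LR in \<open>auto simp flip: ennreal_plus\<close>)
  hence B: "ennreal r * emeasure lborel (?B y) \<le> ennreal (4 * r * L)" for y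
    using mult_left_mono[of "emeasure lborel (?B y)" "ennreal (4 * L)" "ennreal r"] r
    by (simp add: ennreal_mult'[symmetric] mult_ac)
  have "emeasure ?N {p\<in>space ?N. ?P p} \<le> ennreal (4 * r * L) * emeasure M {y\<in>space M. True}"
    by (rule larger_half_bound(1)[where B="?B"]) (use B in \<open>auto simp: abs_if split: if_splits\<close>)
  hence D: "emeasure ?N {p\<in>space ?N. ?P p} \<le> ennreal (4 * r * L)" by (simp add: emeasure_space_1)
  have "emeasure ?N (space ?N - good_pairs M E \<xi> R L) \<le> emeasure ?N ((?D1 \<union> ?D2) \<union> (?C \<union> {p\<in>space ?N. ?P p}))"
    by (rule emeasure_mono) (auto simp: good_pairs_def)
  also have "\<dots> \<le> (emeasure ?N ?D1 + emeasure ?N ?D2) + (emeasure ?N ?C + emeasure ?N {p\<in>space ?N. ?P p})"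
    by (rule order_trans[OF emeasure_subadditive add_mono[OF emeasure_subadditive emeasure_subadditive]]) measurable
  also have "\<dots> \<le> (ennreal w + ennreal w) + (ennreal ((2 * r * R)\<^sup>2) + ennreal (4 * r * L))"
    by (intro add_mono D1 D2 C D)
  also have "\<dots> = ennreal (2 * w + (2 * r * R)\<^sup>2 + 4 * r * L)"
    using w r LR by (simp flip: ennreal_plus add: algebra_simps)
  finally show ?thesis .
qed

end

end

section \<open>Independence of the branches\<close>

definition branch_pair :: "nat \<Rightarrow> nat \<Rightarrow> nat \<Rightarrow> (edge \<Rightarrow> real) \<Rightarrow> (edge \<Rightarrow> real) \<times> (edge \<Rightarrow> real)" where
  "branch_pair n k i J = (block n k (i, False) J, block n k (i, True) J)"

lemma prob_space_coupling_law: "prob_space \<mu> \<Longrightarrow> prob_space (coupling_law n \<mu> k)"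
  unfolding coupling_law_def by (intro prob_space_PiM)

lemma space_coupling_law: "space (coupling_law n \<mu> k) = edges n k \<rightarrow>\<^sub>E space \<mu>"
  by (simp add: coupling_law_def space_PiM)

lemma indep_vars_couplings:
  assumes "prob_space \<mu>" "edges n k \<noteq> {}"
  shows "prob_space.indep_vars (coupling_law n \<mu> k) (\<lambda>_. \<mu>) (\<lambda>e J. J e) (edges n k)"
proof -
  interpret P: prob_space "coupling_law n \<mu> k" by (rule prob_space_coupling_law) fact
  have "distr (coupling_law n \<mu> k) (\<Pi>\<^sub>M e\<in>edges n k. \<mu>) (\<lambda>J. \<lambda>e\<in>edges n k. J e)
      = distr (coupling_law n \<mu> k) (\<Pi>\<^sub>M e\<in>edges n k. \<mu>) (\<lambda>J. J)"
    by (intro distr_cong) (auto simp: space_coupling_law PiE_restrict)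
  also have "\<dots> = (\<Pi>\<^sub>M e\<in>edges n k. \<mu>)" by (simp add: coupling_law_def distr_id)
  also have "\<dots> = (\<Pi>\<^sub>M e\<in>edges n k. distr (coupling_law n \<mu> k) \<mu> (\<lambda>J. J e))"
    using distr_PiM_component[of "edges n k" "\<lambda>_. \<mu>"] assms(1)
    by (intro PiM_cong refl) (simp add: coupling_law_def)
  finally show ?thesis
    using assms(2) by (subst P.indep_vars_iff_distr_eq_PiM') (auto simp: coupling_law_def)
qed

lemma block_measurable [measurable]:
  assumes "c \<in> halves n"
  shows "block n k c \<in> measurable (coupling_law n \<mu> (Suc k)) (coupling_law n \<mu> k)"
  unfolding block_def[abs_def] coupling_law_def
  by (rule measurable_restrict) (use assms in \<open>auto simp: edges_Suc intro!: measurable_component_singleton\<close>)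

lemma distr_block:
  assumes "prob_space \<mu>" and c: "c \<in> halves n"
  shows "distr (coupling_law n \<mu> (Suc k)) (coupling_law n \<mu> k) (block n k c) = coupling_law n \<mu> k"
  using distr_PiM_reindex[of "edges n (Suc k)" "\<lambda>_. \<mu>" "(#) c" "edges n k"] assms
  by (auto simp: coupling_law_def block_def[abs_def] edges_Suc)

text \<open>
  The branches read off disjoint sets of edges, and so do the two halves of a branch; hence the
  pairs of blocks are independent copies of a pair of independent smaller diamonds.
\<close>

lemma distr_branch_pairs:
  assumes \<mu>: "prob_space \<mu>" and n: "n \<ge> 1"
  shows "distr (coupling_law n \<mu> (Suc k)) (\<Pi>\<^sub>M i\<in>{..<n}. coupling_law n \<mu> k \<Otimes>\<^sub>M coupling_law n \<mu> k)
      (\<lambda>J. \<lambda>i\<in>{..<n}. branch_pair n k i J)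
    = (\<Pi>\<^sub>M i\<in>{..<n}. coupling_law n \<mu> k \<Otimes>\<^sub>M coupling_law n \<mu> k)"
proof (cases "edges n (Suc k) = {}")
  case True
  have "replicate (Suc k) (0, True) \<in> edges n (Suc k)" using n by (auto simp: edges_def)
  thus ?thesis using True by auto
next
  case False
  let ?P = "coupling_law n \<mu> (Suc k)" and ?M = "coupling_law n \<mu> k"
  interpret P: prob_space ?P by (rule prob_space_coupling_law) fact
  define K where "K c = (#) c ` edges n k" for c :: half
  have K: "K c \<subseteq> edges n (Suc k)" if "c \<in> halves n" for c using that by (auto simp: K_def edges_Suc)
  have K_disj: "K c \<inter> K d = {}" if "c \<noteq> d" for c d using that by (auto simp: K_def)
  note ind = indep_vars_couplings[OF \<mu> False]
  have block: "(\<lambda>J. block n k c J) \<in> measurable (\<Pi>\<^sub>M e\<in>A. \<mu>) ?M" if "K c \<subseteq> A" for c A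
    unfolding block_def[abs_def] coupling_law_def
    by (rule measurable_restrict) (use that in \<open>auto simp: K_def intro!: measurable_component_singleton\<close>)
  have block_restrict: "block n k c (restrict J A) = block n k c J" if "K c \<subseteq> A" for c A J
    using that by (auto simp: block_def K_def fun_eq_iff)
  have pair: "distr ?P (?M \<Otimes>\<^sub>M ?M) (branch_pair n k i) = ?M \<Otimes>\<^sub>M ?M" if i: "i < n" for i
  proof -
    have c: "(i, h) \<in> halves n" for h using i by simp
    have "P.indep_var (PiM (K (i, False)) (\<lambda>_. \<mu>)) (\<lambda>J. restrict (\<lambda>e. J e) (K (i, False)))
        (PiM (K (i, True)) (\<lambda>_. \<mu>)) (\<lambda>J. restrict (\<lambda>e. J e) (K (i, True)))"
      by (rule P.indep_var_restrict[OF ind K_disj K[OF c] K[OF c]]) simp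
    from P.indep_var_compose[OF this block[OF subset_refl] block[OF subset_refl]]
    have "P.indep_var ?M (block n k (i, False)) ?M (block n k (i, True))"
      by (simp add: comp_def block_restrict)
    thus ?thesis
      unfolding P.indep_var_distribution_eq using distr_block[OF \<mu> c] by (simp add: branch_pair_def[abs_def])
  qed
  define A where "A i = K (i, False) \<union> K (i, True)" for i
  have A: "K (i, h) \<subseteq> A i" for i h by (cases h) (auto simp: A_def)
  have "P.indep_vars (\<lambda>i. PiM (A i) (\<lambda>_. \<mu>)) (\<lambda>i J. restrict (\<lambda>e. J e) (A i)) {..<n}"
  proof (rule P.indep_vars_restrict[OF ind])
    show "A i \<subseteq> edges n (Suc k)" if "i \<in> {..<n}" for i using K that by (auto simp: A_def)
    show "disjoint_family_on A {..<n}"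
      unfolding disjoint_family_on_def A_def using K_disj by (auto simp: Int_Un_distrib Int_Un_distrib2)
  qed
  hence "P.indep_vars (\<lambda>_. ?M \<Otimes>\<^sub>M ?M) (\<lambda>i J. branch_pair n k i (restrict (\<lambda>e. J e) (A i))) {..<n}"
    unfolding branch_pair_def by (rule P.indep_vars_compose2) (intro measurable_Pair block A)
  hence "P.indep_vars (\<lambda>_. ?M \<Otimes>\<^sub>M ?M) (\<lambda>i J. branch_pair n k i J) {..<n}"
    by (simp add: branch_pair_def block_restrict[OF A])
  hence "distr ?P (\<Pi>\<^sub>M i\<in>{..<n}. ?M \<Otimes>\<^sub>M ?M) (\<lambda>J. \<lambda>i\<in>{..<n}. branch_pair n k i J)
      = (\<Pi>\<^sub>M i\<in>{..<n}. distr ?P (?M \<Otimes>\<^sub>M ?M) (\<lambda>J. branch_pair n k i J))"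
    using n by (subst (asm) P.indep_vars_iff_distr_eq_PiM') (auto simp: branch_pair_def[abs_def] lessThan_empty_iff)
  also have "\<dots> = (\<Pi>\<^sub>M i\<in>{..<n}. ?M \<Otimes>\<^sub>M ?M)"
    by (intro PiM_cong refl) (simp add: pair)
  finally show ?thesis .
qed

lemma emeasure_lborel_scale:
  fixes S :: "real set"
  assumes [measurable]: "S \<in> sets borel" and c: "c > 0"
  shows "emeasure lborel {y. y / c \<in> S} = ennreal c * emeasure lborel S"
proof -
  have "emeasure lborel {y. y / c \<in> S} = (\<integral>\<^sup>+y. indicator {y. y / c \<in> S} y \<partial>lborel)" by simp
  also have "\<dots> = ennreal \<bar>c\<bar> * (\<integral>\<^sup>+y. indicator {y. y / c \<in> S} (0 + c * y) \<partial>lborel)"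
    using c by (intro nn_integral_real_affine) auto
  also have "(\<integral>\<^sup>+y. indicator {y. y / c \<in> S} (0 + c * y) \<partial>lborel) = (\<integral>\<^sup>+y. indicator S y \<partial>lborel)"
    using c by (intro nn_integral_cong) (simp add: indicator_def)
  finally show ?thesis using c by simp
qed

theorem proposition5p5:
  fixes n k :: nat and \<beta> r w L R :: real and \<mu> :: "real measure"
  assumes "n \<ge> 1"
    and "\<beta> \<ge> 0"
    and "prob_space \<mu>" and "sets \<mu> = sets borel"
    and "r \<ge> 0" and "0 \<le> w" and "w < 1"
    and "H n \<beta> \<mu> k r w"
    and "L > 0" and "R > 0"
  shows "let \<rho> = r / (1 - w);
             \<omega> = 2 * w + (2 * \<rho> * R)\<^sup>2 + 4 * \<rho> * L;
             \<theta> = (1 + exp (- 2 * L)) / tanh R;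
             \<Gamma> = \<theta> * (\<Sum>g = 1..n. real (n choose g) * kappa g * \<omega> ^ (n - g))
         in H n \<beta> \<mu> (Suc k) (r * \<Gamma>) (\<omega> ^ n)"
proof -
  define \<rho> where "\<rho> = r / (1 - w)"
  define q where "q = 2 * w + (2 * \<rho> * R)\<^sup>2 + 4 * \<rho> * L"
  define \<theta> where "\<theta> = (1 + exp (- 2 * L)) / tanh R"
  define \<Sigma> where "\<Sigma> = (\<Sum>g = 1..n. real (n choose g) * kappa g * q ^ (n - g))"
  let ?M = "coupling_law n \<mu> k" and ?P = "coupling_law n \<mu> (Suc k)"
  let ?\<xi> = "eff_coupling n \<beta> k"
  interpret M: prob_space ?M by (rule prob_space_coupling_law) fact
  interpret P: prob_space ?P by (rule prob_space_coupling_law) fact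
  interpret N: pair_prob_space ?M ?M ..
  have [measurable]: "?\<xi> \<in> borel_measurable ?M" "eff_coupling n \<beta> (Suc k) \<in> borel_measurable ?P"
    using assms(4) by (auto intro: eff_coupling_measurable)
  obtain E where E: "E \<in> sets ?M" and Ew: "M.prob (space ?M - E) \<le> w"
    and Er: "\<And>S. S \<in> sets borel \<Longrightarrow> emeasure ?M (?\<xi> -` S \<inter> E) \<le> ennreal r * emeasure lborel S"
    using assms(8) unfolding H_def by blast
  have Er': "emeasure ?M {x\<in>space ?M. x \<in> E \<and> ?\<xi> x \<in> S} \<le> ennreal r * emeasure lborel S" if "S \<in> sets borel" for S
  proof -
    have "{x\<in>space ?M. x \<in> E \<and> ?\<xi> x \<in> S} = ?\<xi> -` S \<inter> E" using sets.sets_into_space[OF E] by auto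
    thus ?thesis using Er[OF that] by simp
  qed
  \<comment> \<open>If \<open>r\<close> were \<open>0\<close> then \<open>E\<close> would be a null set, contrary to \<open>w < 1\<close>.\<close>
  have "r \<noteq> 0"
  proof
    assume "r = 0"
    hence "M.prob E = 0" using Er[of UNIV] by (simp add: M.emeasure_eq_measure)
    thus False using Ew M.prob_compl[OF E] assms(7) by simp
  qed
  hence r: "r > 0" using assms(5) by simp
  interpret B: bounded_on_event ?M E ?\<xi> r
    by unfold_locales (use E r Er' in auto)
  have \<rho>: "r \<le> \<rho>" using r assms(6,7) by (simp add: \<rho>_def field_simps)
  have q0: "q \<ge> 0" using \<rho> r assms by (simp add: q_def)
  have \<theta>: "\<theta> > 0" using assms by (auto simp: \<theta>_def intro!: divide_pos_pos add_pos_pos)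
  let ?N = "?M \<Otimes>\<^sub>M ?M"
  define G where "G = good_pairs ?M E ?\<xi> R L"
  define X where "X = B.scaled_branch L R"
  have [measurable]: "G \<in> sets ?N" "X \<in> borel_measurable ?N"
    unfolding G_def X_def by (auto intro: B.good_pairs_measurable B.scaled_branch_measurable assms)
  have bad: "emeasure ?N (space ?N - G) \<le> ennreal q"
  proof -
    have "emeasure ?N (space ?N - G) \<le> ennreal (2 * w + (2 * r * R)\<^sup>2 + 4 * r * L)"
      unfolding G_def by (rule B.bad_pairs_bound) (use assms Ew in auto)
    also have "\<dots> \<le> ennreal q"
      unfolding q_def using \<rho> r assms(9,10)
      by (intro ennreal_leI add_mono power_mono mult_right_mono mult_left_mono) auto
    finally show ?thesis .
  qed
  have maj: "majorized (restricted_law ?N G X) (\<lambda>x. ennreal (p2 x))"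
    unfolding G_def X_def by (rule B.branch_majorized) (use assms in auto)
  define \<Phi> where "\<Phi> = (\<lambda>J. \<lambda>i\<in>{..<n}. branch_pair n k i J)"
  let ?\<Pi> = "\<Pi>\<^sub>M i\<in>{..<n}. ?N"
  have \<Phi>[measurable]: "\<Phi> \<in> measurable ?P ?\<Pi>"
    unfolding \<Phi>_def branch_pair_def by (rule measurable_restrict) (auto intro!: measurable_Pair block_measurable)
  have law: "emeasure ?P {J\<in>space ?P. \<Phi> J \<in> A} = emeasure ?\<Pi> A" if "A \<in> sets ?\<Pi>" for A
  proof -
    have "emeasure ?\<Pi> A = emeasure (distr ?P ?\<Pi> \<Phi>) A"
      unfolding \<Phi>_def distr_branch_pairs[OF assms(3,1)] ..
    also have "\<dots> = emeasure ?P (\<Phi> -` A \<inter> space ?P)" using \<Phi> that by (rule emeasure_distr)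
    finally show ?thesis by (simp add: vimage_def Int_def conj_commute)
  qed
  have \<Phi>_space: "\<Phi> J \<in> space ?\<Pi>" if "J \<in> space ?P" for J using \<Phi> that by (rule measurable_space)
  have \<xi>: "r * \<theta> * eff_coupling n \<beta> (Suc k) J = (\<Sum>i\<in>{..<n}. X (\<Phi> J i))" for J
    by (simp add: eff_coupling_Suc \<Phi>_def branch_pair_def X_def B.scaled_branch_def[OF assms(9,10)] \<theta>_def sum_distrib_left)
  define A where "A = {J\<in>space ?P. \<exists>i\<in>{..<n}. \<Phi> J i \<in> G}"
  have [measurable]: "{w\<in>space ?\<Pi>. \<exists>i\<in>{..<n}. w i \<in> G} \<in> sets ?\<Pi>" "{w\<in>space ?\<Pi>. \<forall>i\<in>{..<n}. w i \<notin> G} \<in> sets ?\<Pi>"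
    by measurable
  have A[measurable]: "A \<in> sets ?P"
  proof -
    have "A = \<Phi> -` {w\<in>space ?\<Pi>. \<exists>i\<in>{..<n}. w i \<in> G} \<inter> space ?P" using \<Phi>_space by (auto simp: A_def)
    thus ?thesis by simp
  qed
  have "emeasure ?P (space ?P - A) = emeasure ?P {J\<in>space ?P. \<Phi> J \<in> {w\<in>space ?\<Pi>. \<forall>i\<in>{..<n}. w i \<notin> G}}"
    using \<Phi>_space by (intro arg_cong[of _ _ "emeasure ?P"]) (auto simp: A_def)
  also have "\<dots> = emeasure ?\<Pi> {w\<in>space ?\<Pi>. \<forall>i\<in>{..<n}. w i \<notin> G}" by (rule law) measurable
  also have "\<dots> \<le> ennreal (q ^ card {..<n})" by (rule N.no_good_bound) (auto simp: bad q0)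
  finally have "P.prob (space ?P - A) \<le> q ^ n"
    using q0 by (simp add: P.emeasure_eq_measure)
  moreover have "emeasure ?P (eff_coupling n \<beta> (Suc k) -` S \<inter> A) \<le> ennreal (r * (\<theta> * \<Sigma>)) * emeasure lborel S"
    if S[measurable]: "S \<in> sets borel" for S
  proof -
    \<comment> \<open>Undoing the scaling of the branches by \<open>r * \<theta>\<close> produces the prefactor of the density bound.\<close>
    let ?S = "{y. y / (r * \<theta>) \<in> S}"
    let ?B = "{w\<in>space ?\<Pi>. (\<exists>i\<in>{..<n}. w i \<in> G) \<and> (\<Sum>i\<in>{..<n}. X (w i)) \<in> ?S}"
    have "eff_coupling n \<beta> (Suc k) J \<in> S \<longleftrightarrow> (\<Sum>i\<in>{..<n}. X (\<Phi> J i)) \<in> ?S" for J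
      using r \<theta> by (simp flip: \<xi>)
    hence "emeasure ?P (eff_coupling n \<beta> (Suc k) -` S \<inter> A) = emeasure ?P {J\<in>space ?P. \<Phi> J \<in> ?B}"
      using \<Phi>_space by (intro arg_cong[of _ _ "emeasure ?P"]) (auto simp: A_def)
    also have "\<dots> = emeasure ?\<Pi> ?B" by (rule law) measurable
    also have "\<dots> \<le> ennreal (\<Sum>g = 1..card {..<n}. real (card {..<n} choose g) * kappa g * q ^ (card {..<n} - g)) * emeasure lborel ?S"
      by (rule N.some_good_density_bound) (auto simp: maj bad q0)
    also have "\<dots> = ennreal \<Sigma> * (ennreal (r * \<theta>) * emeasure lborel S)"
      using r \<theta> by (simp add: emeasure_lborel_scale \<Sigma>_def)
    also have "\<dots> = ennreal (r * (\<theta> * \<Sigma>)) * emeasure lborel S"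
    proof -
      have "\<Sigma> \<ge> 0" unfolding \<Sigma>_def using q0 by (intro sum_nonneg) (simp add: kappa_nonneg)
      thus ?thesis using r \<theta> by (simp add: ennreal_mult ac_simps)
    qed
    finally show ?thesis .
  qed
  ultimately have "H n \<beta> \<mu> (Suc k) (r * (\<theta> * \<Sigma>)) (q ^ n)"
    unfolding H_def using A by blast
  thus ?thesis by (simp add: Let_def \<rho>_def q_def \<theta>_def \<Sigma>_def)
qed

end
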